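(* Let $b$ be a nonconstant inner function, let $\mathcal{D}=H^2(\mathbb{T})\ominus\pi(b)H^2(\mathbb{T})$, and let $\{v_i\}_{i=1}^N$ ($N\in\{1,2,\dots\}\cup\{\infty\}$) be an orthonormal basis of $\mathcal{D}$. Then there is a unique Cuntz family $S=\{S_i\}_{i=1}^N$ on $L^2(\mathbb{T})$ satisfying $$S_i(e_n)=v_i b^n,\qquad 1\le i\le N,\ n\in\mathbb{Z}.$$ The endomorphism $\alpha_S$ satisfies $\alpha_S\circ\pi=\pi\circ\beta$ on $L^\infty(\mathbb{T})$. Moreover, each $S_i$ is reduced by $H^2(\mathbb{T})$, and if $R_i$ denotes the restriction of $S_i$ to $H^2(\mathbb{T})$, then $R=\{R_i\}_{i=1}^N$ is a Cuntz family on $H^2(\mathbb{T})$ with $\alpha_R\circ\tau=\tau\circ\beta$ on $L^\infty(\mathbb{T})$.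
   Context: $e_n(z)=z^n$ ($n\in\mathbb{Z}$) is the standard orthonormal basis of $L^2(\mathbb{T})$ (normalized Lebesgue measure). For $\varphi\in L^\infty(\mathbb{T})$, $\pi(\varphi)$ is multiplication by $\varphi$ on $L^2(\mathbb{T})$, and $\tau(\varphi)$ is the Toeplitz operator $P\pi(\varphi)|_{H^2(\mathbb{T})}$ where $P$ is the orthogonal projection of $L^2(\mathbb{T})$ onto $H^2(\mathbb{T})$. $\beta$ is the $*$-endomorphism $\varphi\mapsto\varphi\circ b$ of $L^\infty(\mathbb{T})$. A Cuntz family on a Hilbert space $H$ is a family $\{S_i\}_{i=1}^N$ of isometries with mutually orthogonal ranges whose closed span is $H$, i.e. $S_i^*S_j=\delta_{ij}I$ and $\sum_i S_iS_i^*=I$ (strong convergence if $N=\infty$); it induces the $*$-endomorphism $\alpha_S(T)=\sum_{i=1}^N S_iTS_i^*$ of $B(H)$. *)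

theory Defs
  imports "HOL-Analysis.Analysis" "HOL-Library.Extended_Nat"
begin

text \<open>Concrete model of L2(T).  Elements are (representatives) complex functions on
the complex plane; only their values on the unit circle matter, and two functions
are identified when they agree almost everywhere.  Operators are maps on
representatives, required to respect a.e. equality.\<close>

type_synonym cfun = "complex \<Rightarrow> complex"
type_synonym cop = "cfun \<Rightarrow> cfun"

definition circle :: "complex measure" where
  "circle = distr (uniform_measure lborel {0..2*pi}) borel cis"

definition eq2 :: "cfun \<Rightarrow> cfun \<Rightarrow> bool" where
  "eq2 f g \<longleftrightarrow> (AE z in circle. f z = g z)"

definition L2 :: "cfun set" where
  "L2 = {f. f \<in> borel_measurable circle \<and> integrable circle (\<lambda>z. (cmod (f z))\<^sup>2)}"

definition inner2 :: "cfun \<Rightarrow> cfun \<Rightarrow> complex" where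
  "inner2 f g = (\<integral>z. f z * cnj (g z) \<partial>circle)"

definition norm2 :: "cfun \<Rightarrow> real" where
  "norm2 f = sqrt (\<integral>z. (cmod (f z))\<^sup>2 \<partial>circle)"

definition e :: "int \<Rightarrow> cfun" where
  "e n = (\<lambda>z. z powi n)"

definition fourier :: "cfun \<Rightarrow> int \<Rightarrow> complex" where
  "fourier f n = inner2 f (e n)"

definition H2 :: "cfun set" where
  "H2 = {f \<in> L2. \<forall>n<0. fourier f n = 0}"

definition Linf :: "cfun set" where
  "Linf = {\<phi>. \<phi> \<in> borel_measurable circle \<and> (\<exists>C. AE z in circle. cmod (\<phi> z) \<le> C)}"

definition Hinf :: "cfun set" where
  "Hinf = {\<phi> \<in> Linf. \<forall>n<0. fourier \<phi> n = 0}"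

definition inner_function :: "cfun \<Rightarrow> bool" where
  "inner_function b \<longleftrightarrow> b \<in> Hinf \<and> (AE z in circle. cmod (b z) = 1)"

definition nonconstant :: "cfun \<Rightarrow> bool" where
  "nonconstant b \<longleftrightarrow> \<not> (\<exists>c. eq2 b (\<lambda>_. c))"

definition mult_op :: "cfun \<Rightarrow> cop" where
  "mult_op \<phi> = (\<lambda>f z. \<phi> z * f z)"

definition beta :: "cfun \<Rightarrow> cfun \<Rightarrow> cfun" where
  "beta b \<phi> = \<phi> \<circ> b"

definition projH2 :: cop where
  "projH2 f = (SOME g. g \<in> H2 \<and> (\<forall>h\<in>H2. inner2 (\<lambda>z. f z - g z) h = 0))"

definition toeplitz :: "cfun \<Rightarrow> cop" where
  "toeplitz \<phi> = (\<lambda>f. projH2 (mult_op \<phi> f))"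

definition Dspace :: "cfun \<Rightarrow> cfun set" where
  "Dspace b = {f \<in> H2. \<forall>g\<in>H2. inner2 f (\<lambda>z. b z * g z) = 0}"

definition idx :: "enat \<Rightarrow> nat set" where
  "idx N = {i. 1 \<le> i \<and> enat i \<le> N}"

definition orthonormal_basis :: "nat set \<Rightarrow> (nat \<Rightarrow> cfun) \<Rightarrow> cfun set \<Rightarrow> bool" where
  "orthonormal_basis I v V \<longleftrightarrow>
     (\<forall>i\<in>I. v i \<in> V) \<and>
     (\<forall>i\<in>I. \<forall>j\<in>I. inner2 (v i) (v j) = (if i = j then 1 else 0)) \<and>
     (\<forall>f\<in>V. \<forall>\<epsilon>>0. \<exists>F c. finite F \<and> F \<subseteq> I \<and>
         norm2 (\<lambda>z. f z - (\<Sum>i\<in>F. c i * v i z)) < \<epsilon>)"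

definition bounded_op :: "cfun set \<Rightarrow> cop \<Rightarrow> bool" where
  "bounded_op H A \<longleftrightarrow>
     (\<forall>f\<in>H. A f \<in> H) \<and>
     (\<forall>f\<in>H. \<forall>g\<in>H. eq2 f g \<longrightarrow> eq2 (A f) (A g)) \<and>
     (\<forall>f\<in>H. \<forall>g\<in>H. \<forall>a c. eq2 (A (\<lambda>z. a * f z + c * g z)) (\<lambda>z. a * A f z + c * A g z)) \<and>
     (\<exists>C. \<forall>f\<in>H. norm2 (A f) \<le> C * norm2 f)"

definition op_eq :: "cfun set \<Rightarrow> cop \<Rightarrow> cop \<Rightarrow> bool" where
  "op_eq H A B \<longleftrightarrow> (\<forall>f\<in>H. eq2 (A f) (B f))"

definition is_adjoint :: "cfun set \<Rightarrow> cop \<Rightarrow> cop \<Rightarrow> bool" where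
  "is_adjoint H A A' \<longleftrightarrow> bounded_op H A' \<and> (\<forall>f\<in>H. \<forall>g\<in>H. inner2 (A f) g = inner2 f (A' g))"

definition cuntz_family :: "cfun set \<Rightarrow> nat set \<Rightarrow> (nat \<Rightarrow> cop) \<Rightarrow> bool" where
  "cuntz_family H I S \<longleftrightarrow>
     (\<forall>i\<in>I. bounded_op H (S i)) \<and>
     (\<exists>Sa. (\<forall>i\<in>I. is_adjoint H (S i) (Sa i)) \<and>
        (\<forall>i\<in>I. \<forall>j\<in>I. op_eq H (Sa i \<circ> S j) (if i = j then id else (\<lambda>f z. 0))) \<and>
        (\<forall>f\<in>H. (\<lambda>n. norm2 (\<lambda>z. f z - (\<Sum>i\<in>I \<inter> {..<n}. S i (Sa i f) z))) \<longlonglongrightarrow> 0))"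

text \<open>alpha_S(T) = U : sum_i S_i T S_i^* converges strongly to U on H (for any choice of
representatives of the adjoints).\<close>
definition alpha_eq :: "cfun set \<Rightarrow> nat set \<Rightarrow> (nat \<Rightarrow> cop) \<Rightarrow> cop \<Rightarrow> cop \<Rightarrow> bool" where
  "alpha_eq H I S T U \<longleftrightarrow>
     (\<forall>Sa. (\<forall>i\<in>I. is_adjoint H (S i) (Sa i)) \<longrightarrow>
        (\<forall>f\<in>H. (\<lambda>n. norm2 (\<lambda>z. (\<Sum>i\<in>I \<inter> {..<n}. S i (T (Sa i f)) z) - U f z)) \<longlonglongrightarrow> 0))"

definition reduces :: "cfun set \<Rightarrow> cop \<Rightarrow> bool" where
  "reduces K A \<longleftrightarrow> (\<forall>f\<in>K. A f \<in> K) \<and>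
     (\<forall>A'. is_adjoint L2 A A' \<longrightarrow> (\<forall>f\<in>K. A' f \<in> K))"

end

theory Submission
  imports Defs
begin

text \<open>The operators are \<open>S\<^sub>i f = v\<^sub>i (f \<circ> b)\<close>. The Fourier coefficients of the push-forward of
  \<open>\<bar>v\<^sub>i\<bar>\<^sup>2 dm\<close> under \<open>b\<close> are those of \<open>m\<close>, so this push-forward is \<open>m\<close> and \<open>S\<^sub>i\<close> is a well-defined
  isometry. The ranges are orthogonal because \<open>v\<^sub>i\<close> is orthogonal to \<open>b H\<^sup>2\<close>. They span \<open>L\<^sup>2\<close> by a Wold
  argument: a function orthogonal to all \<open>b\<^sup>n v\<^sub>i\<close> has its projection to \<open>H\<^sup>2\<close>, and likewise its complex
  conjugate, in the intersection of the \<open>b\<^sup>n H\<^sup>2\<close>, which is zero since \<open>b\<close> is not constant. The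
  covariance relations follow from \<open>S\<^sub>i (\<phi> f) = (\<phi> \<circ> b) S\<^sub>i f\<close> and from the fact that \<open>H\<^sup>2\<close> reduces \<open>S\<^sub>i\<close>.\<close>

section \<open>The circle and its Hilbert space\<close>

text \<open>Functions are representatives, so \<open>f \<circ> b\<close> is not obviously well
  defined: \<open>b\<close> might pull a null set back to a set of positive measure. For
  \<open>S i\<close> the weight \<open>v i\<close> settles this, because an isometry sends functions
  of norm 0 to functions of norm 0 (\<open>S_cong\<close>). For the unweighted
  \<open>\<phi> \<circ> b\<close> it becomes available only once the ranges are known to be total
  (\<open>AE_compose_b\<close>), so covariance has to come after totality. One fact about measures,
  that a finite measure on the circle is determined by its moments
  (\<open>circle_measure_eqI\<close>), serves twice: it identifies the push-forward under
  \<open>b\<close>, and it shows that Fourier coefficients determine a function. The latter gives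
  the recurring device of the proof: a property that cuts out a closed subspace need be checked only
  on the \<open>e n\<close>. \<open>reduces\<close> and \<open>alpha_eq\<close> quantify over every
  adjoint, whereas the construction produces one chosen adjoint \<open>Sa\<close>;
  \<open>adjoint_unique\<close> bridges the gap.\<close>

lemma sets_circle [simp, measurable_cong]: "sets circle = sets borel"
  by (simp add: circle_def)

lemma space_circle [simp]: "space circle = UNIV"
  by (simp add: circle_def)

lemma measurable_circle [simp]: "measurable circle M = measurable borel M"
  by (rule measurable_cong_sets) auto

lemma measurable_cis [measurable]: "cis \<in> borel_measurable borel"
  by (intro borel_measurable_continuous_onI continuous_intros)

lemma measurable_cnj [measurable]: "cnj \<in> borel_measurable borel"
  by (intro borel_measurable_continuous_onI continuous_intros)

lemma emeasure_circle_UNIV: "emeasure circle UNIV = 1"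
  unfolding circle_def
  by (subst emeasure_distr) (auto simp: emeasure_uniform_measure_1 ennreal_eq_0_iff not_le)

interpretation circle: finite_measure circle
  by (rule finite_measureI) (simp add: emeasure_circle_UNIV)

lemma measure_circle_UNIV [simp]: "measure circle UNIV = 1"
  by (simp add: measure_def emeasure_circle_UNIV)

lemma AE_circle_cmod: "AE z in circle. cmod z = 1"
  unfolding circle_def by (subst AE_distr_iff) auto

lemma integral_circle:
  fixes f :: "complex \<Rightarrow> complex"
  assumes [measurable]: "f \<in> borel_measurable borel"
  shows "(\<integral>z. f z \<partial>circle) = (\<integral>t. indicator {0..2*pi} t *\<^sub>R f (cis t) \<partial>lborel) / (2*pi)"
proof -
  have "(\<lambda>x. indicator {0..2*pi} x / emeasure lborel {0..2*pi}) =
      (\<lambda>x. ennreal (indicator {0..2*pi} x / (2*pi)))"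
    by (auto simp: fun_eq_iff indicator_def divide_ennreal[symmetric])
  then have "uniform_measure lborel {0..2*pi} =
      density lborel (\<lambda>x. ennreal (indicator {0..2*pi} x / (2*pi)))"
    by (simp add: uniform_measure_def)
  then have "(\<integral>z. f z \<partial>circle) =
      (\<integral>t. (indicator {0..2*pi} t / (2*pi)) *\<^sub>R f (cis t) \<partial>lborel)"
    unfolding circle_def by (simp add: integral_distr integral_density)
  also have "\<dots> = (\<integral>t. (indicator {0..2*pi} t *\<^sub>R f (cis t)) / (2*pi) \<partial>lborel)"
    by (intro Bochner_Integration.integral_cong) (auto simp: scaleR_conv_of_real)
  finally show ?thesis by (simp only: integral_divide_zero)
qed

lemma measurable_powi [measurable]: "(\<lambda>z::complex. z powi n) \<in> borel_measurable borel"
  unfolding power_int_def by measurable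

lemma integral_circle_powi: "(\<integral>z. z powi n \<partial>circle) = (if n = 0 then 1 else 0)"
proof (cases "n = 0")
  case False
  define F where "F t = cis (n * t) / (\<i> * n)" for t :: real
  have "(\<integral>t. indicator {0..2*pi} t *\<^sub>R cis (n * t) \<partial>lborel) = F (2*pi) - F 0"
  proof (rule integral_FTC_Icc)
    show "(F has_vector_derivative cis (real_of_int n * x)) (at x within {0..2*pi})" for x
      unfolding F_def using False
      by (auto intro!: derivative_eq_intros simp: has_vector_derivative_def scaleR_conv_of_real
          fun_eq_iff complex_eq_iff)
  qed (auto intro!: continuous_intros)
  also have "\<dots> = 0"
    using cis_multiple_2pi[of "of_int n"] by (simp add: F_def mult.commute mult.left_commute)
  finally show ?thesis
    using False by (simp add: integral_circle cis_power_int)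
qed simp

section \<open>Vector space structure, inner product and norm on \<open>L2\<close>\<close>

lemma L2_measurable [measurable_dest, simp]: "f \<in> L2 \<Longrightarrow> f \<in> borel_measurable borel"
  by (simp add: L2_def)

lemma L2_integrable: "f \<in> L2 \<Longrightarrow> integrable circle (\<lambda>z. (cmod (f z))\<^sup>2)"
  by (simp add: L2_def del: L2_measurable)

lemma L2I:
  assumes "f \<in> borel_measurable borel" "integrable circle h" "AE z in circle. (cmod (f z))\<^sup>2 \<le> h z"
  shows "f \<in> L2"
proof -
  have [measurable]: "f \<in> borel_measurable borel" by fact
  have "integrable circle (\<lambda>z. (cmod (f z))\<^sup>2)"
  proof (rule Bochner_Integration.integrable_bound[OF assms(2)])
    show "AE z in circle. norm ((cmod (f z))\<^sup>2) \<le> norm (h z)"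
      using assms(3) by eventually_elim auto
  qed measurable
  then show ?thesis using assms(1) by (simp add: L2_def del: L2_measurable)
qed

lemma L2_bounded:
  assumes "f \<in> borel_measurable borel" "AE z in circle. cmod (f z) \<le> C"
  shows "f \<in> L2"
proof (rule L2I[where h="\<lambda>_. C\<^sup>2"])
  show "AE z in circle. (cmod (f z))\<^sup>2 \<le> C\<^sup>2"
    using assms(2) by eventually_elim (auto intro: power_mono)
qed (use assms(1) in auto)

lemma L2_mult_bounded:
  assumes "f \<in> L2" "\<phi> \<in> borel_measurable borel" "AE z in circle. cmod (\<phi> z) \<le> C"
  shows "(\<lambda>z. \<phi> z * f z) \<in> L2"
proof (rule L2I[where h="\<lambda>z. C\<^sup>2 * (cmod (f z))\<^sup>2"])
  show "(\<lambda>z. \<phi> z * f z) \<in> borel_measurable borel" using assms(1,2) by measurable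
  show "integrable circle (\<lambda>z. C\<^sup>2 * (cmod (f z))\<^sup>2)" using L2_integrable[OF assms(1)] by simp
  show "AE z in circle. (cmod (\<phi> z * f z))\<^sup>2 \<le> C\<^sup>2 * (cmod (f z))\<^sup>2"
    using assms(3) by eventually_elim (auto simp: norm_mult power_mult_distrib intro!: mult_right_mono power_mono)
qed

lemma cmod_add_sq: "(cmod (x + y))\<^sup>2 \<le> 2 * (cmod x)\<^sup>2 + 2 * (cmod y)\<^sup>2"
proof -
  have "(cmod (x + y))\<^sup>2 \<le> (cmod x + cmod y)\<^sup>2" by (intro power_mono norm_triangle_ineq) auto
  also have "\<dots> \<le> 2 * (cmod x)\<^sup>2 + 2 * (cmod y)\<^sup>2"
    using sum_squares_bound[of "cmod x" "cmod y"] by (simp add: power2_sum)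
  finally show ?thesis .
qed

lemma L2_zero [simp]: "(\<lambda>z. 0) \<in> L2"
  by (simp add: L2_def del: L2_measurable)

lemma L2_scale [simp]: "f \<in> L2 \<Longrightarrow> (\<lambda>z. a * f z) \<in> L2"
  by (auto simp: L2_def norm_mult power_mult_distrib simp del: L2_measurable)

lemma L2_add [simp]:
  assumes "f \<in> L2" "g \<in> L2" shows "(\<lambda>z. f z + g z) \<in> L2"
  by (rule L2I[where h="\<lambda>z. 2 * (cmod (f z))\<^sup>2 + 2 * (cmod (g z))\<^sup>2"])
    (use assms in \<open>auto intro!: cmod_add_sq L2_integrable\<close>)

lemma L2_diff [simp]:
  assumes "f \<in> L2" "g \<in> L2" shows "(\<lambda>z. f z - g z) \<in> L2"
  using L2_add[OF assms(1) L2_scale[OF assms(2), of "-1"]] by simp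

lemma L2_sum [simp]: "(\<And>i. i \<in> A \<Longrightarrow> f i \<in> L2) \<Longrightarrow> (\<lambda>z. \<Sum>i\<in>A. f i z) \<in> L2"
  by (induction A rule: infinite_finite_induct) auto

lemma L2_cnj [simp]: "f \<in> L2 \<Longrightarrow> (\<lambda>z. cnj (f z)) \<in> L2"
  using measurable_compose[OF _ measurable_cnj] by (auto simp: L2_def simp del: L2_measurable)

lemma L2_integrable_mult:
  assumes "f \<in> L2" "g \<in> L2"
  shows "integrable circle (\<lambda>z. f z * g z)"
proof (rule Bochner_Integration.integrable_bound)
  show "integrable circle (\<lambda>z. (cmod (f z))\<^sup>2 + (cmod (g z))\<^sup>2)"
    using assms by (auto intro: L2_integrable)
  have "cmod x * cmod y \<le> (cmod x)\<^sup>2 + (cmod y)\<^sup>2" for x y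
  proof -
    have "0 \<le> cmod x * cmod y" by simp
    then show ?thesis using sum_squares_bound[of "cmod x" "cmod y"] unfolding mult.assoc by linarith
  qed
  then show "AE z in circle. norm (f z * g z) \<le> norm ((cmod (f z))\<^sup>2 + (cmod (g z))\<^sup>2)"
    by (auto simp: norm_mult)
qed (use assms in measurable)

lemma L2_integrable_inner:
  "f \<in> L2 \<Longrightarrow> g \<in> L2 \<Longrightarrow> integrable circle (\<lambda>z. f z * cnj (g z))"
  by (rule L2_integrable_mult) auto

lemma inner2_add_left: "\<lbrakk>f \<in> L2; g \<in> L2; h \<in> L2\<rbrakk> \<Longrightarrow> inner2 (\<lambda>z. f z + g z) h = inner2 f h + inner2 g h"
  by (simp add: inner2_def distrib_right L2_integrable_inner)

lemma inner2_diff_left: "\<lbrakk>f \<in> L2; g \<in> L2; h \<in> L2\<rbrakk> \<Longrightarrow> inner2 (\<lambda>z. f z - g z) h = inner2 f h - inner2 g h"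
  by (simp add: inner2_def left_diff_distrib L2_integrable_inner)

lemma inner2_scale_left: "inner2 (\<lambda>z. a * f z) h = a * inner2 f h"
  by (simp add: inner2_def mult.assoc)

lemma inner2_cnj: "cnj (inner2 f g) = inner2 g f"
proof -
  have "cnj (inner2 f g) = (\<integral>z. cnj (f z * cnj (g z)) \<partial>circle)"
    unfolding inner2_def by (rule Bochner_Integration.integral_cnj[symmetric])
  then show ?thesis by (simp add: inner2_def mult.commute)
qed

lemma inner2_add_right: "\<lbrakk>f \<in> L2; g \<in> L2; h \<in> L2\<rbrakk> \<Longrightarrow> inner2 h (\<lambda>z. f z + g z) = inner2 h f + inner2 h g"
  by (simp add: inner2_def distrib_left L2_integrable_inner)

lemma inner2_diff_right: "\<lbrakk>f \<in> L2; g \<in> L2; h \<in> L2\<rbrakk> \<Longrightarrow> inner2 h (\<lambda>z. f z - g z) = inner2 h f - inner2 h g"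
  by (simp add: inner2_def right_diff_distrib L2_integrable_inner)

lemma inner2_scale_right: "inner2 h (\<lambda>z. a * f z) = cnj a * inner2 h f"
  using inner2_cnj[of "\<lambda>z. a * f z" h] by (simp add: inner2_scale_left inner2_cnj)

lemma inner2_zero [simp]: "inner2 (\<lambda>z. 0) f = 0" "inner2 f (\<lambda>z. 0) = 0"
  by (simp_all add: inner2_def)

lemma inner2_sum_left:
  assumes "\<And>i. i \<in> A \<Longrightarrow> f i \<in> L2" "h \<in> L2"
  shows "inner2 (\<lambda>z. \<Sum>i\<in>A. f i z) h = (\<Sum>i\<in>A. inner2 (f i) h)"
  using assms by (induction A rule: infinite_finite_induct) (auto simp: inner2_add_left)

lemma inner2_sum_diff_left:
  assumes "\<And>i. i \<in> A \<Longrightarrow> f i \<in> L2" "g \<in> L2" "h \<in> L2"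
  shows "inner2 (\<lambda>z. (\<Sum>i\<in>A. f i z) - g z) h = (\<Sum>i\<in>A. inner2 (f i) h) - inner2 g h"
proof -
  have "(\<lambda>z. \<Sum>i\<in>A. f i z) \<in> L2" by (rule L2_sum) (rule assms(1))
  then have "inner2 (\<lambda>z. (\<Sum>i\<in>A. f i z) - g z) h = inner2 (\<lambda>z. \<Sum>i\<in>A. f i z) h - inner2 g h"
    by (rule inner2_diff_left[OF _ assms(2,3)])
  also have "inner2 (\<lambda>z. \<Sum>i\<in>A. f i z) h = (\<Sum>i\<in>A. inner2 (f i) h)"
    by (rule inner2_sum_left) (rule assms(1), assumption, rule assms(3))
  finally show ?thesis .
qed

lemma inner2_cong:
  assumes "eq2 f f'" "eq2 g g'"
    and [measurable]: "f \<in> borel_measurable borel" "f' \<in> borel_measurable borel"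
      "g \<in> borel_measurable borel" "g' \<in> borel_measurable borel"
  shows "inner2 f g = inner2 f' g'"
proof -
  have "AE z in circle. f z * cnj (g z) = f' z * cnj (g' z)"
    using assms(1,2) unfolding eq2_def by eventually_elim simp
  then show ?thesis unfolding inner2_def by (intro integral_cong_AE) auto
qed

lemma eq2_refl [simp]: "eq2 f f"
  by (simp add: eq2_def)

lemma eq2_sym: "eq2 f g \<Longrightarrow> eq2 g f"
  unfolding eq2_def by (erule eventually_mono) simp

lemma eq2_trans [trans]: "eq2 f g \<Longrightarrow> eq2 g h \<Longrightarrow> eq2 f h"
  unfolding eq2_def by (erule (1) eventually_elim2) simp

lemma norm2_nonneg [simp]: "norm2 f \<ge> 0"
  by (simp add: norm2_def)

lemma norm2_sq: "(norm2 f)\<^sup>2 = (\<integral>z. (cmod (f z))\<^sup>2 \<partial>circle)"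
  by (simp add: norm2_def)

lemma inner2_self: "inner2 f f = of_real ((norm2 f)\<^sup>2)"
  unfolding norm2_sq inner2_def
  by (simp flip: complex_norm_square integral_complex_of_real del: of_real_power)

lemma norm2_sq_Re: "(norm2 f)\<^sup>2 = Re (inner2 f f)"
  by (simp add: inner2_self)

lemma norm2_zero [simp]: "norm2 (\<lambda>z. 0) = 0"
  by (simp add: norm2_def)

lemma norm2_cong:
  assumes "eq2 f g" "f \<in> borel_measurable borel" "g \<in> borel_measurable borel"
  shows "norm2 f = norm2 g"
  by (metis assms inner2_cong norm2_sq_Re norm2_nonneg power2_eq_imp_eq)

lemma norm2_eq_0_iff:
  assumes "f \<in> L2" shows "norm2 f = 0 \<longleftrightarrow> eq2 f (\<lambda>z. 0)"
proof -
  have "norm2 f = 0 \<longleftrightarrow> (\<integral>z. (cmod (f z))\<^sup>2 \<partial>circle) = 0" by (simp add: norm2_def)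
  also have "\<dots> \<longleftrightarrow> (AE z in circle. (cmod (f z))\<^sup>2 = 0)"
    by (rule integral_nonneg_eq_0_iff_AE) (use assms L2_integrable in auto)
  finally show ?thesis by (simp add: eq2_def)
qed

lemma eq2_iff_norm2:
  assumes "f \<in> L2" "g \<in> L2" shows "eq2 f g \<longleftrightarrow> norm2 (\<lambda>z. f z - g z) = 0"
  using norm2_eq_0_iff[OF L2_diff[OF assms]] by (simp add: eq2_def)

lemma norm2_scale: "norm2 (\<lambda>z. a * f z) = cmod a * norm2 f"
  by (simp add: norm2_def norm_mult power_mult_distrib real_sqrt_mult)

lemma norm2_minus_commute: "norm2 (\<lambda>z. f z - g z) = norm2 (\<lambda>z. g z - f z)"
  by (simp add: norm2_def norm_minus_commute)

lemma norm2_add_sq: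
  assumes "f \<in> L2" "g \<in> L2"
  shows "(norm2 (\<lambda>z. f z + g z))\<^sup>2 = (norm2 f)\<^sup>2 + 2 * Re (inner2 f g) + (norm2 g)\<^sup>2"
proof -
  have "Re (inner2 g f) = Re (inner2 f g)" by (simp flip: inner2_cnj[of f g])
  then show ?thesis using assms by (simp add: norm2_sq_Re inner2_add_left inner2_add_right)
qed

lemma norm2_diff_sq:
  assumes "f \<in> L2" "g \<in> L2"
  shows "(norm2 (\<lambda>z. f z - g z))\<^sup>2 = (norm2 f)\<^sup>2 - 2 * Re (inner2 f g) + (norm2 g)\<^sup>2"
  using norm2_add_sq[OF assms(1) L2_scale[OF assms(2), of "-1"]] norm2_scale[of "-1" g]
    inner2_scale_right[of f "-1" g]
  by simp

lemma inner2_CS: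
  assumes "f \<in> L2" "g \<in> L2"
  shows "cmod (inner2 f g) \<le> norm2 f * norm2 g"
proof (cases "norm2 g = 0")
  case True
  then have "inner2 f g = inner2 f (\<lambda>z. 0)"
    using assms by (intro inner2_cong) (auto simp: norm2_eq_0_iff)
  with True show ?thesis by simp
next
  case False
  then have G: "(norm2 g)\<^sup>2 > 0" by simp
  \<comment> \<open>\<open>c * g\<close> is the projection of \<open>f\<close> onto the line through
    \<open>g\<close>; the inequality is nonnegativity of the squared residual.\<close>
  define c where "c = inner2 f g / of_real ((norm2 g)\<^sup>2)"
  have "Re (inner2 f (\<lambda>z. c * g z)) = (cmod (inner2 f g))\<^sup>2 / (norm2 g)\<^sup>2"
    unfolding c_def inner2_scale_right
    by (simp add: mult.commute complex_norm_square[symmetric] flip: of_real_power of_real_divide)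
  moreover have "(norm2 (\<lambda>z. c * g z))\<^sup>2 = (cmod (inner2 f g))\<^sup>2 / (norm2 g)\<^sup>2"
    unfolding norm2_scale using False
    by (simp add: c_def norm_divide norm_mult power_divide power_mult_distrib power2_eq_square)
  ultimately have "(norm2 f)\<^sup>2 - (cmod (inner2 f g))\<^sup>2 / (norm2 g)\<^sup>2 = (norm2 (\<lambda>z. f z - c * g z))\<^sup>2"
    using norm2_diff_sq[OF assms(1) L2_scale[OF assms(2)], of c] by simp
  then have "(cmod (inner2 f g))\<^sup>2 / (norm2 g)\<^sup>2 \<le> (norm2 f)\<^sup>2"
    using zero_le_power2[of "norm2 (\<lambda>z. f z - c * g z)"] by linarith
  then have "(cmod (inner2 f g))\<^sup>2 \<le> (norm2 f * norm2 g)\<^sup>2"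
    using G by (simp add: power_mult_distrib field_simps)
  then show ?thesis by (rule power2_le_imp_le) simp
qed

lemma norm2_triangle:
  assumes "f \<in> L2" "g \<in> L2"
  shows "norm2 (\<lambda>z. f z + g z) \<le> norm2 f + norm2 g"
proof (rule power2_le_imp_le)
  have "Re (inner2 f g) \<le> norm2 f * norm2 g"
    using inner2_CS[OF assms] complex_Re_le_cmod order_trans by blast
  then show "(norm2 (\<lambda>z. f z + g z))\<^sup>2 \<le> (norm2 f + norm2 g)\<^sup>2"
    by (simp add: norm2_add_sq[OF assms] power2_sum)
qed simp

lemma norm2_triangle_diff:
  assumes "f \<in> L2" "g \<in> L2" "h \<in> L2"
  shows "norm2 (\<lambda>z. f z - h z) \<le> norm2 (\<lambda>z. f z - g z) + norm2 (\<lambda>z. g z - h z)"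
  using norm2_triangle[of "\<lambda>z. f z - g z" "\<lambda>z. g z - h z"] assms by simp

lemma norm2_mult_bounded:
  assumes "f \<in> L2" "\<phi> \<in> borel_measurable borel" "AE z in circle. cmod (\<phi> z) \<le> C" "C \<ge> 0"
  shows "norm2 (\<lambda>z. \<phi> z * f z) \<le> C * norm2 f"
proof (rule power2_le_imp_le)
  have "(norm2 (\<lambda>z. \<phi> z * f z))\<^sup>2 \<le> (\<integral>z. C\<^sup>2 * (cmod (f z))\<^sup>2 \<partial>circle)"
    unfolding norm2_sq
  proof (rule integral_mono_AE)
    show "integrable circle (\<lambda>z. (cmod (\<phi> z * f z))\<^sup>2)"
      using L2_mult_bounded[OF assms(1-3)] L2_integrable by blast
    show "integrable circle (\<lambda>z. C\<^sup>2 * (cmod (f z))\<^sup>2)" using L2_integrable[OF assms(1)] by simp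
    show "AE z in circle. (cmod (\<phi> z * f z))\<^sup>2 \<le> C\<^sup>2 * (cmod (f z))\<^sup>2"
      using assms(3)
      by eventually_elim (auto simp: norm_mult power_mult_distrib intro!: mult_right_mono power_mono)
  qed
  also have "\<dots> = (C * norm2 f)\<^sup>2" by (simp add: norm2_sq power_mult_distrib)
  finally show "(norm2 (\<lambda>z. \<phi> z * f z))\<^sup>2 \<le> (C * norm2 f)\<^sup>2" .
qed (use assms in simp)

lemma inner2_tendsto_left:
  assumes "(\<lambda>n. norm2 (\<lambda>z. f z - u n z)) \<longlonglongrightarrow> 0" "f \<in> L2" "\<And>n. u n \<in> L2" "g \<in> L2"
  shows "(\<lambda>n. inner2 (u n) g) \<longlonglongrightarrow> inner2 f g"
proof (rule LIM_zero_cancel, rule Lim_null_comparison)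
  show "\<forall>\<^sub>F n in sequentially. norm (inner2 (u n) g - inner2 f g) \<le> norm2 (\<lambda>z. f z - u n z) * norm2 g"
    using assms inner2_CS[of "\<lambda>z. u _ z - f z" g]
    by (auto simp: inner2_diff_left norm2_minus_commute[of f])
  show "(\<lambda>n. norm2 (\<lambda>z. f z - u n z) * norm2 g) \<longlonglongrightarrow> 0"
    using tendsto_mult_right[OF assms(1), of "norm2 g"] by simp
qed

lemma e_in_L2 [simp]: "e n \<in> L2"
  unfolding e_def
proof (rule L2_bounded[where C=1])
  show "AE z in circle. cmod (z powi n) \<le> 1"
    using AE_circle_cmod by eventually_elim (simp add: norm_power_int)
qed simp

lemma AE_cnj_powi: "AE z in circle. cnj (z powi n) = z powi (-n)"
  using AE_circle_cmod
proof eventually_elim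
  case (elim z)
  then have "cnj z = inverse z"
    by (metis complex_div_cnj divide_inverse mult_1_left of_real_1 one_power2 div_by_1 complex_cnj_one)
  then show ?case by (simp add: cis_power_int power_int_minus power_int_inverse)
qed

lemma inner2_e: "inner2 (e n) (e m) = (if n = m then 1 else 0)"
proof -
  have "inner2 (e n) (e m) = (\<integral>z. z powi (n - m) \<partial>circle)"
    unfolding inner2_def e_def
  proof (rule integral_cong_AE)
    show "AE z in circle. z powi n * cnj (z powi m) = z powi (n - m)"
      using AE_cnj_powi[of m] AE_circle_cmod
      by eventually_elim (subst power_int_diff, auto simp: power_int_minus divide_inverse)
  qed auto
  then show ?thesis by (simp add: integral_circle_powi)
qed

section \<open>Completeness and orthogonal projections\<close>

lemma L2_imp_nn_integral: "f \<in> L2 \<Longrightarrow> (\<integral>\<^sup>+z. ennreal ((cmod (f z))\<^sup>2) \<partial>circle) = ennreal ((norm2 f)\<^sup>2)"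
  by (subst nn_integral_eq_integral) (auto simp: norm2_sq intro: L2_integrable)

lemma nn_integral_imp_L2:
  assumes [measurable]: "f \<in> borel_measurable borel"
    and "(\<integral>\<^sup>+z. ennreal ((cmod (f z))\<^sup>2) \<partial>circle) \<le> ennreal (c\<^sup>2)" "c \<ge> 0"
  shows "f \<in> L2" "norm2 f \<le> c"
proof -
  have "integrable circle (\<lambda>z. (cmod (f z))\<^sup>2)"
    using assms(2) by (intro integrableI_nonneg) (auto intro: order.strict_trans1)
  then show L2: "f \<in> L2" by (simp add: L2_def del: L2_measurable)
  show "norm2 f \<le> c"
    using assms(2,3) by (auto simp: L2_imp_nn_integral[OF L2] power2_le_iff_abs_le)
qed

text \<open>Cauchy-Schwarz against the constant 1, which has norm 1 because \<open>circle\<close> is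
  a probability measure. This L1 bound makes the telescoping series in
  \<open>L2_fast_Cauchy_limit\<close> summable almost everywhere.\<close>

lemma L2_integral_cmod:
  assumes "f \<in> L2"
  shows "(\<integral>\<^sup>+z. ennreal (cmod (f z)) \<partial>circle) \<le> ennreal (norm2 f)"
proof -
  define g where "g z = complex_of_real (cmod (f z))" for z
  have [measurable]: "f \<in> borel_measurable borel" using assms by simp
  have g: "g \<in> L2"
    unfolding g_def by (rule L2I[OF _ L2_integrable[OF assms]]) auto
  have 1: "(\<lambda>z. 1) \<in> L2" "norm2 (\<lambda>z. 1) = 1"
    by (auto simp: norm2_def intro: L2_bounded[where C=1])
  have int: "integrable circle (\<lambda>z. cmod (f z))"
    using integrable_norm[OF L2_integrable_mult[OF assms 1(1)]] by simp
  have "inner2 g (\<lambda>z. 1) = complex_of_real (\<integral>z. cmod (f z) \<partial>circle)"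
    by (simp add: inner2_def g_def)
  moreover have "norm2 g = norm2 f" by (simp add: norm2_def g_def)
  ultimately have "(\<integral>z. cmod (f z) \<partial>circle) \<le> norm2 f"
    using inner2_CS[OF g 1(1)] 1(2) by simp
  then show ?thesis
    by (subst nn_integral_eq_integral[OF int]) (auto intro: ennreal_leI)
qed

text \<open>Riesz-Fischer for a rapidly Cauchy sequence: the increments have L1 norms at most
  \<open>(1/2)^k\<close>, so the sum of their moduli is integrable, hence finite a.e., and the
  sequence converges pointwise there.\<close>

lemma L2_fast_Cauchy_limit:
  assumes w: "\<And>k. w k \<in> L2"
    and cauchy: "\<And>k m n. k \<le> m \<Longrightarrow> k \<le> n \<Longrightarrow> norm2 (\<lambda>z. w m z - w n z) \<le> (1/2)^k"
  shows "\<exists>f\<in>L2. \<forall>k. norm2 (\<lambda>z. f z - w k z) \<le> (1/2)^k"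
proof -
  have [measurable]: "w k \<in> borel_measurable borel" for k using w by simp
  \<comment> \<open>Where the sequence diverges, \<open>lim\<close> is an unspecified value;
    \<open>f\<close> is measurable all the same, and the divergence set turns out to be
    null.\<close>
  define f where "f z = lim (\<lambda>k. w k z)" for z
  have f_meas [measurable]: "f \<in> borel_measurable borel" unfolding f_def by measurable
  define D where "D k z = cmod (w (Suc k) z - w k z)" for k z
  have [measurable]: "D k \<in> borel_measurable borel" for k unfolding D_def by measurable
  have "(\<integral>\<^sup>+z. (\<Sum>k. ennreal (D k z)) \<partial>circle) = (\<Sum>k. \<integral>\<^sup>+z. ennreal (D k z) \<partial>circle)"
    by (rule nn_integral_suminf) simp
  also have "\<dots> \<le> (\<Sum>k. ennreal ((1/2)^k))"
  proof (intro suminf_le)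
    fix k
    have "(\<integral>\<^sup>+z. ennreal (D k z) \<partial>circle) \<le> ennreal (norm2 (\<lambda>z. w (Suc k) z - w k z))"
      unfolding D_def by (rule L2_integral_cmod) (simp add: w)
    also have "\<dots> \<le> ennreal ((1/2)^k)" by (intro ennreal_leI cauchy) auto
    finally show "(\<integral>\<^sup>+z. ennreal (D k z) \<partial>circle) \<le> ennreal ((1/2)^k)" .
  qed auto
  also have "\<dots> = ennreal (\<Sum>k. (1/2)^k)"
    by (rule suminf_ennreal2) (auto intro!: summable_geometric)
  finally have "(\<integral>\<^sup>+z. (\<Sum>k. ennreal (D k z)) \<partial>circle) \<noteq> \<infinity>"
    by (auto simp: top_unique)
  then have "AE z in circle. (\<Sum>k. ennreal (D k z)) \<noteq> \<infinity>"
    by (intro nn_integral_PInf_AE) auto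
  then have lim: "AE z in circle. (\<lambda>k. w k z) \<longlonglongrightarrow> f z"
  proof eventually_elim
    case (elim z)
    then have "summable (\<lambda>k. D k z)"
      by (intro summable_suminf_not_top) (auto simp: D_def)
    then have "summable (\<lambda>k. w (Suc k) z - w k z)"
      unfolding D_def by (rule summable_norm_cancel)
    then have "convergent (\<lambda>k. \<Sum>i<k. w (Suc i) z - w i z)"
      by (simp add: summable_iff_convergent)
    then have "convergent (\<lambda>k. w k z - w 0 z)"
      by (simp add: sum_lessThan_telescope[of "\<lambda>i. w i z"])
    then have "convergent (\<lambda>k. w k z)"
      using convergent_diff_const_right_iff[of "\<lambda>k. w k z" "w 0 z"] by simp
    then show ?case unfolding f_def by (simp add: convergent_LIMSEQ_iff)
  qed
  have *: "(\<lambda>z. f z - w k z) \<in> L2 \<and> norm2 (\<lambda>z. f z - w k z) \<le> (1/2)^k" for k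
  proof -
    have "(\<integral>\<^sup>+z. ennreal ((cmod (f z - w k z))\<^sup>2) \<partial>circle)
        = (\<integral>\<^sup>+z. liminf (\<lambda>j. ennreal ((cmod (w j z - w k z))\<^sup>2)) \<partial>circle)"
    proof (rule nn_integral_cong_AE)
      show "AE z in circle. ennreal ((cmod (f z - w k z))\<^sup>2)
          = liminf (\<lambda>j. ennreal ((cmod (w j z - w k z))\<^sup>2))"
        using lim
      proof eventually_elim
        case (elim z)
        then have "(\<lambda>j. ennreal ((cmod (w j z - w k z))\<^sup>2)) \<longlonglongrightarrow> ennreal ((cmod (f z - w k z))\<^sup>2)"
          by (intro tendsto_intros)
        from lim_imp_Liminf[OF _ this] show ?case by simp
      qed
    qed
    \<comment> \<open>Fatou's lemma carries the Cauchy bound for \<open>w j - w k\<close> over to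
      \<open>f - w k\<close>.\<close>
    also have "\<dots> \<le> liminf (\<lambda>j. \<integral>\<^sup>+z. ennreal ((cmod (w j z - w k z))\<^sup>2) \<partial>circle)"
      by (rule nn_integral_liminf) measurable
    also have "\<dots> = liminf (\<lambda>j. ennreal ((norm2 (\<lambda>z. w j z - w k z))\<^sup>2))"
      using w by (simp add: L2_imp_nn_integral)
    also have "\<dots> \<le> limsup (\<lambda>j. ennreal ((norm2 (\<lambda>z. w j z - w k z))\<^sup>2))"
      by (rule Liminf_le_Limsup) simp
    also have "\<dots> \<le> ennreal (((1/2)^k)\<^sup>2)"
    proof (rule Limsup_bounded)
      show "\<forall>\<^sub>F j in sequentially. ennreal ((norm2 (\<lambda>z. w j z - w k z))\<^sup>2) \<le> ennreal (((1/2)^k)\<^sup>2)"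
        using eventually_ge_at_top[of k]
        by eventually_elim (intro ennreal_leI power_mono cauchy, auto)
    qed
    finally have "(\<integral>\<^sup>+z. ennreal ((cmod (f z - w k z))\<^sup>2) \<partial>circle) \<le> ennreal (((1/2)^k)\<^sup>2)" .
    then show ?thesis
      using nn_integral_imp_L2[of "\<lambda>z. f z - w k z" "(1/2)^k"] by simp
  qed
  have "f \<in> L2" using L2_add[OF conjunct1[OF *[of 0]] w[of 0]] by simp
  with * show ?thesis by blast
qed

lemma L2_complete:
  assumes u: "\<And>n. u n \<in> L2"
    and cauchy: "\<And>\<epsilon>. \<epsilon> > 0 \<Longrightarrow> \<exists>M. \<forall>m\<ge>M. \<forall>n\<ge>M. norm2 (\<lambda>z. u m z - u n z) < \<epsilon>"
  shows "\<exists>f\<in>L2. (\<lambda>n. norm2 (\<lambda>z. f z - u n z)) \<longlonglongrightarrow> 0"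
proof -
  have "\<exists>M. \<forall>m\<ge>M. \<forall>n\<ge>M. norm2 (\<lambda>z. u m z - u n z) < (1/2)^k" for k
    by (rule cauchy) simp
  then obtain M where M: "\<And>k m n. m \<ge> M k \<Longrightarrow> n \<ge> M k \<Longrightarrow> norm2 (\<lambda>z. u m z - u n z) < (1/2)^k"
    by metis
  \<comment> \<open>Partial sums instead of \<open>M k\<close> itself: they are nondecreasing in
    \<open>k\<close> and still at least \<open>M k\<close>. Repeated indices do no harm.\<close>
  define r where "r k = (\<Sum>i\<le>k. M i)" for k
  have r_mono: "r i \<le> r j" if "i \<le> j" for i j
    unfolding r_def using that by (intro sum_mono2) auto
  have M_le_r: "M k \<le> r k" for k unfolding r_def by (rule member_le_sum) auto
  have "\<exists>f\<in>L2. \<forall>k. norm2 (\<lambda>z. f z - u (r k) z) \<le> (1/2)^k"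
  proof (rule L2_fast_Cauchy_limit)
    fix k m n :: nat assume "k \<le> m" "k \<le> n"
    then have "M k \<le> r m" "M k \<le> r n" using M_le_r[of k] r_mono order_trans by blast+
    then show "norm2 (\<lambda>z. u (r m) z - u (r n) z) \<le> (1/2)^k"
      by (rule M[THEN less_imp_le])
  qed (rule u)
  then obtain f where f: "f \<in> L2" and fr: "\<And>k. norm2 (\<lambda>z. f z - u (r k) z) \<le> (1/2)^k"
    by blast
  have "(\<lambda>n. norm2 (\<lambda>z. f z - u n z)) \<longlonglongrightarrow> 0"
  proof (rule LIMSEQ_I)
    fix \<epsilon> :: real assume "\<epsilon> > 0"
    then obtain k where k: "(1/2)^k < \<epsilon>/2" using real_arch_pow_inv[of "\<epsilon>/2" "1/2"] by auto
    have "norm2 (\<lambda>z. f z - u n z) < \<epsilon>" if "n \<ge> r k" for n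
    proof -
      have "norm2 (\<lambda>z. f z - u n z) \<le> norm2 (\<lambda>z. f z - u (r k) z) + norm2 (\<lambda>z. u (r k) z - u n z)"
        by (rule norm2_triangle_diff) (auto intro: u f)
      also have "\<dots> < \<epsilon>/2 + \<epsilon>/2"
        using fr[of k] M[of k "r k" n] M_le_r[of k] that k by linarith
      finally show ?thesis by simp
    qed
    then show "\<exists>no. \<forall>n\<ge>no. norm (norm2 (\<lambda>z. f z - u n z) - 0) < \<epsilon>" by auto
  qed
  with f show ?thesis by blast
qed

section \<open>Closed subspaces and orthogonal projection\<close>

definition closed_subspace :: "cfun set \<Rightarrow> bool" where
  "closed_subspace K \<longleftrightarrow> K \<subseteq> L2 \<and> (\<lambda>z. 0) \<in> K
    \<and> (\<forall>f\<in>K. \<forall>g\<in>K. \<forall>a c. (\<lambda>z. a * f z + c * g z) \<in> K)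
    \<and> (\<forall>f\<in>L2. \<forall>u. (\<forall>n. u n \<in> K) \<longrightarrow> (\<lambda>n. norm2 (\<lambda>z. f z - u n z)) \<longlonglongrightarrow> 0 \<longrightarrow> f \<in> K)"

lemma closed_subspaceI:
  assumes "K \<subseteq> L2" "(\<lambda>z. 0) \<in> K"
    "\<And>f g a c. f \<in> K \<Longrightarrow> g \<in> K \<Longrightarrow> (\<lambda>z. a * f z + c * g z) \<in> K"
    "\<And>f u. f \<in> L2 \<Longrightarrow> (\<And>n. u n \<in> K) \<Longrightarrow> (\<lambda>n. norm2 (\<lambda>z. f z - u n z)) \<longlonglongrightarrow> 0 \<Longrightarrow> f \<in> K"
  shows "closed_subspace K"
  using assms unfolding closed_subspace_def by blast

lemma closed_subspaceD:
  assumes "closed_subspace K"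
  shows "f \<in> K \<Longrightarrow> f \<in> L2" "(\<lambda>z. 0) \<in> K"
    "f \<in> K \<Longrightarrow> g \<in> K \<Longrightarrow> (\<lambda>z. a * f z + c * g z) \<in> K"
    "\<lbrakk>f \<in> L2; \<And>n. u n \<in> K; (\<lambda>n. norm2 (\<lambda>z. f z - u n z)) \<longlonglongrightarrow> 0\<rbrakk> \<Longrightarrow> f \<in> K"
  using assms unfolding closed_subspace_def by blast+

lemma closed_subspace_add: "closed_subspace K \<Longrightarrow> f \<in> K \<Longrightarrow> g \<in> K \<Longrightarrow> (\<lambda>z. f z + g z) \<in> K"
  using closed_subspaceD(3)[of K f g 1 1] by simp

lemma closed_subspace_diff: "closed_subspace K \<Longrightarrow> f \<in> K \<Longrightarrow> g \<in> K \<Longrightarrow> (\<lambda>z. f z - g z) \<in> K"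
  using closed_subspaceD(3)[of K f g 1 "-1"] by simp

lemma closed_subspace_scale: "closed_subspace K \<Longrightarrow> f \<in> K \<Longrightarrow> (\<lambda>z. a * f z) \<in> K"
  using closed_subspaceD(3)[of K f f a 0] by simp

lemma closed_subspace_sum:
  assumes "closed_subspace K"
  shows "(\<And>i. i \<in> A \<Longrightarrow> f i \<in> K) \<Longrightarrow> (\<lambda>z. \<Sum>i\<in>A. f i z) \<in> K"
  by (induction A rule: infinite_finite_induct)
    (auto intro: closed_subspace_add[OF assms] closed_subspaceD(2)[OF assms])

text \<open>Closedness under norm limits, applied to a constant sequence. A closed subspace thus
  contains, with a function, all its representatives in \<open>L2\<close>, so a.e. identities can be
  used to prove membership.\<close>

lemma closed_subspace_eq2:
  assumes K: "closed_subspace K" and "g \<in> K" "f \<in> L2" "eq2 f g"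
  shows "f \<in> K"
proof (rule closed_subspaceD(4)[OF K, of f "\<lambda>_. g"])
  have "norm2 (\<lambda>z. f z - g z) = 0"
    using assms eq2_iff_norm2 closed_subspaceD(1) by blast
  then show "(\<lambda>n. norm2 (\<lambda>z. f z - g z)) \<longlonglongrightarrow> 0" by simp
qed (use assms in auto)

lemma closed_subspace_L2: "closed_subspace L2"
  by (rule closed_subspaceI) auto

lemma closed_subspace_Int:
  assumes "closed_subspace K" "closed_subspace V"
  shows "closed_subspace (K \<inter> V)"
  using assms unfolding closed_subspace_def by blast

text \<open>Continuity of the inner product. Several closed subspaces below are recognized in this
  form, among them \<open>H2\<close> and
  \<open>{f \<in> L2. powmult b k f \<in> H2}\<close>.\<close>

lemma closed_subspace_orth:
  assumes "G \<subseteq> L2"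
  shows "closed_subspace {f \<in> L2. \<forall>g\<in>G. inner2 f g = 0}"
proof (rule closed_subspaceI)
  fix f u assume f: "f \<in> L2" and u: "\<And>n. u n \<in> {f \<in> L2. \<forall>g\<in>G. inner2 f g = 0}"
    and lim: "(\<lambda>n. norm2 (\<lambda>z. f z - u n z)) \<longlonglongrightarrow> 0"
  have "inner2 f g = 0" if "g \<in> G" for g
  proof (rule LIMSEQ_unique)
    show "(\<lambda>n. inner2 (u n) g) \<longlonglongrightarrow> inner2 f g"
      by (rule inner2_tendsto_left[OF lim f]) (use u that assms in auto)
    show "(\<lambda>n. inner2 (u n) g) \<longlonglongrightarrow> 0" using u that by simp
  qed
  with f show "f \<in> {f \<in> L2. \<forall>g\<in>G. inner2 f g = 0}" by blast
next
  fix f g a c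
  assume fg: "f \<in> {f \<in> L2. \<forall>g\<in>G. inner2 f g = 0}" "g \<in> {f \<in> L2. \<forall>g\<in>G. inner2 f g = 0}"
  have "inner2 (\<lambda>z. a * f z + c * g z) h = 0" if "h \<in> G" for h
  proof -
    have "inner2 (\<lambda>z. a * f z + c * g z) h = inner2 (\<lambda>z. a * f z) h + inner2 (\<lambda>z. c * g z) h"
      by (rule inner2_add_left) (use fg that assms in auto)
    with fg that show ?thesis by (simp add: inner2_scale_left)
  qed
  with fg show "(\<lambda>z. a * f z + c * g z) \<in> {f \<in> L2. \<forall>g\<in>G. inner2 f g = 0}"
    by simp
qed auto

lemma norm2_parallelogram:
  assumes "f \<in> L2" "g \<in> L2"
  shows "(norm2 (\<lambda>z. f z - g z))\<^sup>2 + (norm2 (\<lambda>z. f z + g z))\<^sup>2 = 2 * (norm2 f)\<^sup>2 + 2 * (norm2 g)\<^sup>2"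
  by (simp add: norm2_add_sq norm2_diff_sq assms)

text \<open>A minimizing sequence for the distance from \<open>f\<close> to \<open>K\<close> is
  Cauchy by the parallelogram law. Its limit is a minimizer, and a residual not orthogonal to some
  \<open>h \<in> K\<close> could be shortened by moving along \<open>h\<close>.\<close>

theorem L2_projection:
  assumes K: "closed_subspace K" and f: "f \<in> L2"
  shows "\<exists>g\<in>K. \<forall>h\<in>K. inner2 (\<lambda>z. f z - g z) h = 0"
proof -
  note KL2 = closed_subspaceD(1)[OF K]
  define d where "d = (INF g\<in>K. norm2 (\<lambda>z. f z - g z))"
  have bdd: "bdd_below ((\<lambda>g. norm2 (\<lambda>z. f z - g z)) ` K)" by (rule bdd_belowI2[of _ 0]) simp
  have d_le: "d \<le> norm2 (\<lambda>z. f z - g z)" if "g \<in> K" for g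
    unfolding d_def using bdd that by (rule cINF_lower)
  have d0: "d \<ge> 0" unfolding d_def using closed_subspaceD(2)[OF K] by (intro cINF_greatest) auto
  have "\<exists>g\<in>K. norm2 (\<lambda>z. f z - g z) < d + inverse (Suc n)" for n
  proof -
    have "d < d + inverse (Suc n)" by simp
    then show ?thesis
      unfolding d_def using bdd closed_subspaceD(2)[OF K] by (subst (asm) cINF_less_iff) auto
  qed
  then obtain u where u: "\<And>n. u n \<in> K" and ud: "\<And>n. norm2 (\<lambda>z. f z - u n z) < d + inverse (Suc n)"
    by metis
  have lim: "(\<lambda>n. norm2 (\<lambda>z. f z - u n z)) \<longlonglongrightarrow> d"
  proof (rule tendsto_sandwich[where f="\<lambda>_. d"])
    show "(\<lambda>n. d + inverse (Suc n)) \<longlonglongrightarrow> d"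
      using tendsto_add[OF tendsto_const LIMSEQ_inverse_real_of_nat, of d] by simp
  qed (use d_le u ud in \<open>auto intro!: always_eventually less_imp_le\<close>)
  have "\<exists>M. \<forall>m\<ge>M. \<forall>n\<ge>M. norm2 (\<lambda>z. u m z - u n z) < \<epsilon>" if "\<epsilon> > 0" for \<epsilon>
  proof -
    have "(\<lambda>n. (norm2 (\<lambda>z. f z - u n z))\<^sup>2) \<longlonglongrightarrow> d\<^sup>2" by (intro tendsto_power lim)
    moreover have "d\<^sup>2 < d\<^sup>2 + \<epsilon>\<^sup>2/4" using that by simp
    ultimately have "\<forall>\<^sub>F n in sequentially. (norm2 (\<lambda>z. f z - u n z))\<^sup>2 < d\<^sup>2 + \<epsilon>\<^sup>2/4"
      by (rule order_tendstoD)
    then obtain M where M: "\<And>n. n \<ge> M \<Longrightarrow> (norm2 (\<lambda>z. f z - u n z))\<^sup>2 < d\<^sup>2 + \<epsilon>\<^sup>2/4"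
      unfolding eventually_sequentially by auto
    have "norm2 (\<lambda>z. u m z - u n z) < \<epsilon>" if "m \<ge> M" "n \<ge> M" for m n
    proof (rule power2_less_imp_less)
      \<comment> \<open>The midpoint stays in \<open>K\<close>, so its distance to \<open>f\<close>
        is at least \<open>d\<close>. The slack \<open>\<epsilon>^2/4\<close> from \<open>M\<close>
        enters four times in the parallelogram law and adds up to
        \<open>\<epsilon>^2\<close>.\<close>
      define h where "h z = (1/2) * u m z + (1/2) * u n z" for z
      have h: "h \<in> K" unfolding h_def by (rule closed_subspaceD(3)[OF K u u])
      have "(norm2 (\<lambda>z. (f z - u n z) - (f z - u m z)))\<^sup>2 + (norm2 (\<lambda>z. (f z - u n z) + (f z - u m z)))\<^sup>2
          = 2 * (norm2 (\<lambda>z. f z - u n z))\<^sup>2 + 2 * (norm2 (\<lambda>z. f z - u m z))\<^sup>2"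
        by (rule norm2_parallelogram) (auto simp: f u KL2)
      moreover have "(\<lambda>z. (f z - u n z) + (f z - u m z)) = (\<lambda>z. 2 * (f z - h z))"
        by (auto simp: h_def fun_eq_iff)
      moreover have "norm2 (\<lambda>z. 2 * (f z - h z)) = 2 * norm2 (\<lambda>z. f z - h z)"
        using norm2_scale[of 2 "\<lambda>z. f z - h z"] by simp
      moreover have "d\<^sup>2 \<le> (norm2 (\<lambda>z. f z - h z))\<^sup>2"
        using d_le[OF h] d0 by (intro power_mono)
      ultimately show "(norm2 (\<lambda>z. u m z - u n z))\<^sup>2 < \<epsilon>\<^sup>2"
        using M[OF \<open>m \<ge> M\<close>] M[OF \<open>n \<ge> M\<close>] by (simp add: power_mult_distrib)
    qed (use \<open>\<epsilon> > 0\<close> in simp)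
    then show ?thesis by blast
  qed
  then obtain g where gL2: "g \<in> L2" and g: "(\<lambda>n. norm2 (\<lambda>z. g z - u n z)) \<longlonglongrightarrow> 0"
    using L2_complete[of u] u KL2 by blast
  have gK: "g \<in> K" by (rule closed_subspaceD(4)[OF K gL2 u g])
  have min: "norm2 (\<lambda>z. f z - g z) \<le> d"
  proof (rule LIMSEQ_le_const)
    show "(\<lambda>n. norm2 (\<lambda>z. f z - u n z) + norm2 (\<lambda>z. g z - u n z)) \<longlonglongrightarrow> d"
      using tendsto_add[OF lim g] by simp
    show "\<exists>N. \<forall>n\<ge>N. norm2 (\<lambda>z. f z - g z) \<le> norm2 (\<lambda>z. f z - u n z) + norm2 (\<lambda>z. g z - u n z)"
      using norm2_triangle_diff[of f "u _" g] f u KL2 gL2 norm2_minus_commute[of g] by auto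
  qed
  have "inner2 (\<lambda>z. f z - g z) h = 0" if h: "h \<in> K" for h
  proof (rule ccontr)
    define r where "r z = f z - g z" for z
    have r: "r \<in> L2" unfolding r_def by (simp add: f gL2)
    define a where "a = inner2 r h"
    assume "inner2 (\<lambda>z. f z - g z) h \<noteq> 0"
    then have a: "(cmod a)\<^sup>2 > 0" by (simp add: a_def r_def[abs_def])
    \<comment> \<open>Step length: the gain \<open>2 * t * |a|^2\<close> beats the cost
      \<open>t^2 * |a|^2 * |h|^2\<close> once \<open>t * |h|^2 < 1\<close>; the added 1 keeps
      \<open>t\<close> positive when \<open>h\<close> has norm 0.\<close>
    define t where "t = inverse ((norm2 h)\<^sup>2 + 1)"
    have "(norm2 h)\<^sup>2 + 1 > 0" using zero_le_power2[of "norm2 h"] by linarith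
    then have t: "t > 0" "t * (norm2 h)\<^sup>2 < 1" by (auto simp: t_def divide_simps)
    have k: "(\<lambda>z. 1 * g z + (of_real t * a) * h z) \<in> K" by (rule closed_subspaceD(3)[OF K gK h])
    have "norm2 r \<le> norm2 (\<lambda>z. r z - (of_real t * a) * h z)"
      using order_trans[OF min d_le[OF k]] by (simp add: r_def[abs_def] diff_diff_eq)
    then have "(norm2 r)\<^sup>2 \<le> (norm2 (\<lambda>z. r z - (of_real t * a) * h z))\<^sup>2"
      by (intro power_mono) auto
    also have "\<dots> = (norm2 r)\<^sup>2 - 2 * Re (cnj (of_real t * a) * a) + (cmod (of_real t * a) * norm2 h)\<^sup>2"
      using norm2_diff_sq[OF r L2_scale[OF KL2[OF h]], of "of_real t * a"]
      by (simp only: inner2_scale_right a_def[symmetric] norm2_scale)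
    also have "Re (cnj (of_real t * a) * a) = t * (cmod a)\<^sup>2"
      unfolding cmod_power2 by (simp add: power2_eq_square algebra_simps)
    also have "(cmod (of_real t * a) * norm2 h)\<^sup>2 = (t * (cmod a)\<^sup>2) * (t * (norm2 h)\<^sup>2)"
      by (simp add: norm_mult power_mult_distrib power2_eq_square mult_ac)
    finally have "2 * (t * (cmod a)\<^sup>2) \<le> (t * (cmod a)\<^sup>2) * (t * (norm2 h)\<^sup>2)" by simp
    moreover have "t * (cmod a)\<^sup>2 > 0" using t a by simp
    ultimately have "2 \<le> t * (norm2 h)\<^sup>2" by (metis mult.commute mult_le_cancel_left_pos)
    with t show False by simp
  qed
  with gK show ?thesis by blast
qed

lemma inner2_self_eq_0: "f \<in> L2 \<Longrightarrow> inner2 f f = 0 \<Longrightarrow> eq2 f (\<lambda>z. 0)"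
  by (simp add: inner2_self norm2_eq_0_iff)

text \<open>The component of \<open>f \<in> V\<close> orthogonal to \<open>K\<close> stays in
  \<open>V\<close> because \<open>K \<subseteq> V\<close>, so it vanishes by \<open>dense\<close>.
  Every density argument below goes through this criterion.\<close>

lemma closed_subspace_eqI:
  assumes K: "closed_subspace K" and V: "closed_subspace V" and "K \<subseteq> V"
    and dense: "\<And>f. f \<in> V \<Longrightarrow> (\<And>g. g \<in> K \<Longrightarrow> inner2 f g = 0) \<Longrightarrow> eq2 f (\<lambda>z. 0)"
  shows "K = V"
proof
  show "V \<subseteq> K"
  proof
    fix f assume f: "f \<in> V"
    then have fL2: "f \<in> L2" using closed_subspaceD(1)[OF V] by blast
    then obtain g where g: "g \<in> K" "\<And>h. h \<in> K \<Longrightarrow> inner2 (\<lambda>z. f z - g z) h = 0"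
      using L2_projection[OF K] by blast
    have "(\<lambda>z. f z - g z) \<in> V"
      using f g(1) \<open>K \<subseteq> V\<close> closed_subspace_diff[OF V] by blast
    then have "eq2 (\<lambda>z. f z - g z) (\<lambda>z. 0)" using g(2) by (rule dense)
    then have "eq2 f g" by (simp add: eq2_def)
    then show "f \<in> K" by (rule closed_subspace_eq2[OF K g(1) fL2])
  qed
qed fact

section \<open>Uniqueness of Fourier coefficients\<close>

text \<open>Closed sets form an intersection-stable generator of the Borel sets, and the indicator
  of a nonempty closed \<open>C\<close> is the pointwise limit of the continuous functions
  \<open>max 0 (1 - n * infdist x C)\<close>, which have values between 0 and 1.\<close>

lemma finite_measure_eqI_continuous:
  fixes M N :: "'a::metric_space measure"
  assumes fin: "finite_measure M" "finite_measure N" and sets: "sets M = sets borel" "sets N = sets borel"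
    and eq: "\<And>f :: 'a \<Rightarrow> real. continuous_on UNIV f \<Longrightarrow> (\<And>x. \<bar>f x\<bar> \<le> 1) \<Longrightarrow>
      (\<integral>x. f x \<partial>M) = (\<integral>x. f x \<partial>N)"
  shows "M = N"
proof (rule measure_eqI_generator_eq[where E="Collect closed" and \<Omega>=UNIV and A="\<lambda>_. UNIV"])
  have lim: "(\<lambda>n. \<integral>x. max 0 (1 - real n * infdist x C) \<partial>L) \<longlonglongrightarrow> measure L C"
    if C: "closed C" "C \<noteq> {}" and L: "finite_measure L" "sets L = sets borel" for C L
  proof -
    interpret L: finite_measure L by fact
    have space: "space L = UNIV" using sets_eq_imp_space_eq[OF L(2)] by simp
    have [measurable]: "C \<in> sets L" using C by (simp add: L(2))
    have "(\<lambda>n. \<integral>x. max 0 (1 - real n * infdist x C) \<partial>L) \<longlonglongrightarrow> (\<integral>x. indicator C x \<partial>L)"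
    proof (rule integral_dominated_convergence[where w="\<lambda>_. 1::real"])
      show "(\<lambda>x. max 0 (1 - real n * infdist x C)) \<in> borel_measurable L" for n
        by (subst measurable_cong_sets[OF L(2) refl])
          (intro borel_measurable_continuous_onI continuous_intros)
      show "AE x in L. (\<lambda>n. max 0 (1 - real n * infdist x C)) \<longlonglongrightarrow> indicator C x"
      proof (intro AE_I2)
        fix x
        show "(\<lambda>n. max 0 (1 - real n * infdist x C)) \<longlonglongrightarrow> indicator C x"
        proof (cases "x \<in> C")
          case False
          then have d: "infdist x C > 0"
            using in_closed_iff_infdist_zero[OF C] infdist_nonneg[of x C] by (metis less_eq_real_def)
          obtain k :: nat where k: "1 < real k * infdist x C"
            using reals_Archimedean3[OF d] by blast
          have "max 0 (1 - real n * infdist x C) = 0" if "n \<ge> k" for n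
          proof -
            have "real k * infdist x C \<le> real n * infdist x C"
              using that d by (intro mult_right_mono) auto
            with k show ?thesis by simp
          qed
          then show ?thesis
            using False by (intro tendsto_eventually) (auto simp: eventually_sequentially)
        qed (use C in simp)
      qed
      show "AE x in L. norm (max 0 (1 - real n * infdist x C)) \<le> 1" for n
        by (intro AE_I2) (simp add: infdist_nonneg zero_le_mult_iff)
    qed (auto intro: L.integrable_const)
    then show ?thesis by (simp add: space)
  qed
  fix C :: "'a set" assume "C \<in> Collect closed"
  then have C: "closed C" by simp
  show "emeasure M C = emeasure N C"
  proof (cases "C = {}")
    case False
    have "(\<integral>x. max 0 (1 - real n * infdist x C) \<partial>M) = (\<integral>x. max 0 (1 - real n * infdist x C) \<partial>N)" for n
      by (intro eq continuous_intros) (auto simp: infdist_nonneg zero_le_mult_iff)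
    then have "measure M C = measure N C"
      using lim[OF C False fin(1) sets(1)] lim[OF C False fin(2) sets(2)] LIMSEQ_unique by simp
    then show ?thesis
      using finite_measure.emeasure_eq_measure fin by metis
  qed simp
next
  show "emeasure M UNIV \<noteq> \<infinity>" using fin(1) finite_measure.emeasure_finite by auto
qed (auto simp: sets borel_eq_closed Int_stable_def)

text \<open>On the circle the conjugate of \<open>z\<close> is \<open>inverse z\<close>, so a
  real-linear functional is a combination of \<open>z\<close> and \<open>inverse z\<close>.
  Multiplying by it only shifts moments by one, which drives the induction in
  \<open>circle_measure_eqI\<close>.\<close>

lemma bounded_linear_circle:
  assumes f: "bounded_linear (f :: complex \<Rightarrow> real)"
  obtains \<alpha> \<gamma> where "\<And>z. cmod z = 1 \<Longrightarrow> complex_of_real (f z) = \<alpha> * z + \<gamma> * inverse z"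
proof -
  interpret bounded_linear f by fact
  define \<alpha> \<gamma> where "\<alpha> = (complex_of_real (f 1) - \<i> * f \<i>) / 2"
    and "\<gamma> = (complex_of_real (f 1) + \<i> * f \<i>) / 2"
  show thesis
  proof
    fix z :: complex assume z: "cmod z = 1"
    then have inv: "inverse z = cnj z" by (simp add: inverse_complex_def complex_eq_iff cmod_def)
    have "f z = f (Re z *\<^sub>R 1 + Im z *\<^sub>R \<i>)" by (rule arg_cong[where f=f]) (simp add: complex_eq_iff)
    also have "\<dots> = Re z * f 1 + Im z * f \<i>" unfolding add scaleR by simp
    finally show "complex_of_real (f z) = \<alpha> * z + \<gamma> * inverse z"
      unfolding inv \<alpha>_def \<gamma>_def by (simp add: complex_eq_iff field_simps)
  qed
qed

lemma circle_measure_integrable: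
  fixes M :: "complex measure" and h :: "complex \<Rightarrow> complex"
  assumes "finite_measure M" "sets M = sets borel" "AE z in M. cmod z = 1" "continuous_on UNIV h"
  shows "integrable M (\<lambda>z. h z * z powi n)"
proof -
  interpret finite_measure M by fact
  have "compact (h ` sphere 0 1)"
    using assms(4) continuous_on_subset by (intro compact_continuous_image) auto
  then have "bounded (h ` sphere 0 1)" by (rule compact_imp_bounded)
  then obtain C where "\<forall>w\<in>h ` sphere 0 1. cmod w \<le> C"
    unfolding bounded_iff by blast
  then have C: "cmod (h z) \<le> C" if "cmod z = 1" for z using that by simp
  have [measurable]: "h \<in> borel_measurable borel"
    by (rule borel_measurable_continuous_onI) fact
  show ?thesis
  proof (rule integrable_const_bound)
    show "AE z in M. norm (h z * z powi n) \<le> C"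
      using assms(3) by eventually_elim (auto simp: norm_mult norm_power_int C)
    show "(\<lambda>z. h z * z powi n) \<in> borel_measurable M"
      by (subst measurable_cong_sets[OF assms(2) refl]) measurable
  qed
qed

text \<open>By Stone-Weierstrass, real polynomials in the coordinates approximate a continuous
  function uniformly on the circle, and the integral of such a polynomial is determined by the
  moments.\<close>

lemma circle_measure_eqI:
  fixes M N :: "complex measure"
  assumes fin: "finite_measure M" "finite_measure N" and sets: "sets M = sets borel" "sets N = sets borel"
    and AE: "AE z in M. cmod z = 1" "AE z in N. cmod z = 1"
    and eq: "\<And>n :: int. (\<integral>z. z powi n \<partial>M) = (\<integral>z. z powi n \<partial>N)"
  shows "M = N"
proof (rule finite_measure_eqI_continuous[OF fin sets])
  interpret M: finite_measure M by fact
  interpret N: finite_measure N by fact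
  note int = circle_measure_integrable[OF fin(1) sets(1) AE(1)] circle_measure_integrable[OF fin(2) sets(2) AE(2)]
  \<comment> \<open>All moments of \<open>h\<close> are compared, not only its integral, because
    multiplication by a linear polynomial shifts the index.\<close>
  define good :: "cfun \<Rightarrow> bool" where "good h \<longleftrightarrow> continuous_on UNIV h \<and>
    (\<forall>n::int. (\<integral>z. h z * z powi n \<partial>M) = (\<integral>z. h z * z powi n \<partial>N))" for h
  \<comment> \<open>Quantifying over every \<open>h\<close> inside the induction makes the product
    case immediate: multiply by one factor, then by the other.\<close>
  have good_mult: "\<forall>h. good h \<longrightarrow> good (\<lambda>z. complex_of_real (g z) * h z)"
    if "real_polynomial_function g" for g
    using that
  proof (induction rule: real_polynomial_function.induct)
    case (linear f)
    obtain \<alpha> \<gamma> where f: "\<And>z. cmod z = 1 \<Longrightarrow> complex_of_real (f z) = \<alpha> * z + \<gamma> * inverse z"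
      using bounded_linear_circle[OF linear] by blast
    show ?case
    proof (intro allI impI)
      fix h assume h: "good h"
      then have hc: "continuous_on UNIV h" by (simp add: good_def)
      have fc: "continuous_on UNIV (\<lambda>z. complex_of_real (f z) * h z)"
        using linear_continuous_on[OF linear] hc by (intro continuous_intros)
      have "(\<integral>z. complex_of_real (f z) * h z * z powi n \<partial>L) =
          \<alpha> * (\<integral>z. h z * z powi (n + 1) \<partial>L) + \<gamma> * (\<integral>z. h z * z powi (n - 1) \<partial>L)"
        if L: "finite_measure L" "sets L = sets borel" "AE z in L. cmod z = 1" for L n
      proof -
        note i = circle_measure_integrable[OF L]
        have "(\<integral>z. complex_of_real (f z) * h z * z powi n \<partial>L) =
          (\<integral>z. \<alpha> * (h z * z powi (n + 1)) + \<gamma> * (h z * z powi (n - 1)) \<partial>L)"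
        proof (rule integral_cong_AE)
          show "AE z in L. complex_of_real (f z) * h z * z powi n =
              \<alpha> * (h z * z powi (n + 1)) + \<gamma> * (h z * z powi (n - 1))"
            using L(3)
          proof eventually_elim
            case (elim z)
            then have "z \<noteq> 0" by auto
            then show ?case
              by (simp add: f[OF elim] power_int_add power_int_diff field_simps)
          qed
          show "(\<lambda>z. complex_of_real (f z) * h z * z powi n) \<in> borel_measurable L"
            using i[OF fc] by simp
          show "(\<lambda>z. \<alpha> * (h z * z powi (n + 1)) + \<gamma> * (h z * z powi (n - 1))) \<in> borel_measurable L"
            using i[OF hc, of "n + 1"] i[OF hc, of "n - 1"] by measurable
        qed
        also have "\<dots> = \<alpha> * (\<integral>z. h z * z powi (n + 1) \<partial>L) + \<gamma> * (\<integral>z. h z * z powi (n - 1) \<partial>L)"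
          using i[OF hc] by simp
        finally show ?thesis .
      qed
      from this[OF fin(1) sets(1) AE(1)] this[OF fin(2) sets(2) AE(2)] h fc
      show "good (\<lambda>z. complex_of_real (f z) * h z)" by (simp add: good_def)
    qed
  next
    case (const c)
    show ?case by (auto simp: good_def mult.assoc intro!: continuous_intros)
  next
    case (add f g)
    show ?case
    proof (intro allI impI)
      fix h assume "good h"
      with add have 1: "good (\<lambda>z. complex_of_real (f z) * h z)" and 2: "good (\<lambda>z. complex_of_real (g z) * h z)"
        by auto
      have "continuous_on UNIV (\<lambda>z. complex_of_real (f z) * h z + complex_of_real (g z) * h z)"
        using 1 2 by (intro continuous_on_add) (auto simp: good_def)
      then show "good (\<lambda>z. complex_of_real (f z + g z) * h z)"
        using 1 2 int[of "\<lambda>z. complex_of_real (f z) * h z"] int[of "\<lambda>z. complex_of_real (g z) * h z"]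
        by (simp add: good_def distrib_right)
    qed
  next
    case (mult f g)
    then show ?case by (simp add: mult.assoc)
  qed
  have good1: "good (\<lambda>z. 1)" using eq by (auto simp: good_def)
  have poly: "(\<integral>z. g z \<partial>M) = (\<integral>z. g z \<partial>N)" if "real_polynomial_function g" for g
  proof -
    have "(\<integral>z. complex_of_real (g z) * 1 * z powi 0 \<partial>M) = (\<integral>z. complex_of_real (g z) * 1 * z powi 0 \<partial>N)"
      using good_mult[OF that, rule_format, OF good1] unfolding good_def by blast
    then show ?thesis by simp
  qed
  fix f :: "complex \<Rightarrow> real" assume f: "continuous_on UNIV f" "\<And>x. \<bar>f x\<bar> \<le> 1"
  have intR: "integrable L g"
    if "continuous_on UNIV g" "finite_measure L" "sets L = sets borel" "AE z in L. cmod z = 1"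
    for L and g :: "complex \<Rightarrow> real"
    using circle_measure_integrable[OF that(2-4), of "\<lambda>z. complex_of_real (g z)" 0] that(1)
    by (simp add: continuous_on_of_real complex_of_real_integrable_eq)
  define m where "m = measure M UNIV + measure N UNIV"
  have "\<bar>(\<integral>z. f z \<partial>M) - (\<integral>z. f z \<partial>N)\<bar> \<le> \<epsilon> * m" if "\<epsilon> > 0" for \<epsilon>
  proof -
    obtain g where g: "real_polynomial_function g" "\<And>z. z \<in> sphere 0 1 \<Longrightarrow> \<bar>f z - g z\<bar> < \<epsilon>"
      by (rule Stone_Weierstrass_real_polynomial_function[of "sphere (0::complex) 1" f \<epsilon>])
        (use continuous_on_subset[OF f(1)] \<open>\<epsilon> > 0\<close> in auto)
    have gc: "continuous_on UNIV g"
      using g(1) continuous_on_polymonial_function real_polynomial_function_eq by blast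
    have "\<bar>(\<integral>z. f z \<partial>L) - (\<integral>z. g z \<partial>L)\<bar> \<le> \<epsilon> * measure L UNIV"
      if L: "finite_measure L" "sets L = sets borel" "AE z in L. cmod z = 1" for L
    proof -
      interpret L: finite_measure L by fact
      have "space L = UNIV" using sets_eq_imp_space_eq[OF L(2)] by simp
      have "\<bar>(\<integral>z. f z \<partial>L) - (\<integral>z. g z \<partial>L)\<bar> = \<bar>\<integral>z. f z - g z \<partial>L\<bar>"
        using intR[OF f(1) L] intR[OF gc L] by simp
      also have "\<dots> \<le> (\<integral>z. \<bar>f z - g z\<bar> \<partial>L)" by (rule integral_abs_bound)
      also have "\<dots> \<le> (\<integral>z. \<epsilon> \<partial>L)"
      proof (rule integral_mono_AE)
        show "AE z in L. \<bar>f z - g z\<bar> \<le> \<epsilon>"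
          using L(3) by eventually_elim (use g(2) in \<open>auto intro: less_imp_le\<close>)
      qed (use intR[OF f(1) L] intR[OF gc L] in auto)
      finally show ?thesis by (simp add: \<open>space L = UNIV\<close> mult.commute)
    qed
    from this[OF fin(1) sets(1) AE(1)] this[OF fin(2) sets(2) AE(2)] poly[OF g(1)]
    show ?thesis by (simp add: m_def distrib_left)
  qed
  then have *: "\<bar>(\<integral>z. f z \<partial>M) - (\<integral>z. f z \<partial>N)\<bar> \<le> 0 + \<delta>" if "\<delta> > 0" for \<delta>
  proof -
    have m: "m \<ge> 0" by (simp add: m_def)
    \<comment> \<open>Dividing by \<open>m + 1\<close> rather than \<open>m\<close> also covers the
      case that both measures vanish.\<close>
    have "\<delta> / (m + 1) * m \<le> \<delta>" using m that by (simp add: field_simps)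
    moreover have "\<delta> / (m + 1) > 0" using m that by simp
    ultimately show ?thesis
      using \<open>\<And>\<epsilon>. \<epsilon> > 0 \<Longrightarrow> \<bar>(\<integral>z. f z \<partial>M) - (\<integral>z. f z \<partial>N)\<bar> \<le> \<epsilon> * m\<close>[of "\<delta> / (m + 1)"]
      by linarith
  qed
  have "\<bar>(\<integral>z. f z \<partial>M) - (\<integral>z. f z \<partial>N)\<bar> \<le> 0"
    by (rule field_le_epsilon) (rule *)
  then show "(\<integral>z. f z \<partial>M) = (\<integral>z. f z \<partial>N)" by simp
qed

text \<open>The positive and negative parts of \<open>g\<close> are densities of finite measures
  with the same moments, so they agree a.e.; at most one of them is nonzero at any point, hence both
  vanish.\<close>

lemma real_moments_eq_0:
  fixes g :: "complex \<Rightarrow> real"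
  assumes g: "integrable circle g"
    and moments: "\<And>n :: int. (\<integral>z. complex_of_real (g z) * z powi n \<partial>circle) = 0"
  shows "AE z in circle. g z = 0"
proof -
  have [measurable]: "g \<in> borel_measurable borel" using borel_measurable_integrable[OF g] by simp
  define M where "M h = density circle (\<lambda>z. ennreal (h z))" for h :: "complex \<Rightarrow> real"
  define gp where "gp z = max 0 (g z)" for z
  define gm where "gm z = max 0 (- g z)" for z
  have [measurable]: "gp \<in> borel_measurable borel" "gm \<in> borel_measurable borel"
    unfolding gp_def gm_def by measurable
  have int: "integrable circle gp" "integrable circle gm"
    unfolding gp_def gm_def using g by auto
  have nn: "gp z \<ge> 0" "gm z \<ge> 0" for z by (auto simp: gp_def gm_def)
  have fin: "finite_measure (M h)" if "integrable circle h" for h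
  proof (rule finite_measureI)
    have [measurable]: "h \<in> borel_measurable borel" using borel_measurable_integrable[OF that] by simp
    have "emeasure (M h) UNIV = (\<integral>\<^sup>+z. ennreal (h z) \<partial>circle)"
      by (simp add: M_def emeasure_density)
    also have "\<dots> \<noteq> \<infinity>" using integrableD(2)[OF that] that real_integrable_def by blast
    finally show "emeasure (M h) (space (M h)) \<noteq> \<infinity>" by (simp add: M_def)
  qed
  have ae: "AE z in M h. cmod z = 1" if "integrable circle h" for h
  proof -
    have [measurable]: "h \<in> borel_measurable borel" using borel_measurable_integrable[OF that] by simp
    show ?thesis unfolding M_def using AE_circle_cmod by (subst AE_density) auto
  qed
  have mom: "(\<integral>z. z powi n \<partial>M h) = (\<integral>z. complex_of_real (h z) * z powi n \<partial>circle)"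
    if "h \<in> borel_measurable borel" "\<And>z. h z \<ge> 0" for h n
    unfolding M_def using that by (subst integral_density) (auto simp: scaleR_conv_of_real)
  have int': "integrable circle (\<lambda>z. complex_of_real (h z) * z powi n)" if "integrable circle h" for h n
  proof (rule Bochner_Integration.integrable_bound[OF that])
    show "AE z in circle. norm (complex_of_real (h z) * z powi n) \<le> norm (h z)"
      using AE_circle_cmod by eventually_elim (simp add: norm_mult norm_power_int)
    have [measurable]: "h \<in> borel_measurable borel" using borel_measurable_integrable[OF that] by simp
    show "(\<lambda>z. complex_of_real (h z) * z powi n) \<in> borel_measurable circle" by simp
  qed
  have "M gp = M gm"
  proof (rule circle_measure_eqI[OF fin[OF int(1)] fin[OF int(2)]])
    fix n :: int
    have "(\<integral>z. z powi n \<partial>M gp) - (\<integral>z. z powi n \<partial>M gm) =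
        (\<integral>z. complex_of_real (gp z) * z powi n - complex_of_real (gm z) * z powi n \<partial>circle)"
      using int'[OF int(1)] int'[OF int(2)] nn by (simp add: mom)
    also have "\<dots> = (\<integral>z. complex_of_real (g z) * z powi n \<partial>circle)"
      by (intro Bochner_Integration.integral_cong) (auto simp: gp_def gm_def max_def)
    finally show "(\<integral>z. z powi n \<partial>M gp) = (\<integral>z. z powi n \<partial>M gm)" using moments by simp
  qed (use ae[OF int(1)] ae[OF int(2)] in \<open>auto simp: M_def\<close>)
  then have "AE z in circle. ennreal (gp z) = ennreal (gm z)"
    unfolding M_def by (subst (asm) circle.density_unique_iff) auto
  then show ?thesis
    by eventually_elim (auto simp: gp_def gm_def max_def split: if_splits)
qed

lemma fourier_powi: "f \<in> L2 \<Longrightarrow> fourier f n = (\<integral>z. f z * z powi (- n) \<partial>circle)"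
  unfolding fourier_def inner2_def e_def
proof (rule integral_cong_AE)
  show "AE z in circle. f z * cnj (z powi n) = f z * z powi (- n)"
    using AE_cnj_powi[of n] by eventually_elim simp
qed simp_all

lemma fourier_cnj:
  assumes "f \<in> L2" shows "fourier (\<lambda>z. cnj (f z)) n = cnj (fourier f (-n))"
proof -
  have "fourier (\<lambda>z. cnj (f z)) n = (\<integral>z. cnj (f z * z powi n) \<partial>circle)"
    unfolding fourier_def inner2_def e_def by simp
  then show ?thesis
    using assms by (simp only: Bochner_Integration.integral_cnj fourier_powi minus_minus)
qed

text \<open>The moments of the conjugate of \<open>f\<close> are the conjugate moments at the
  opposite index, so they vanish too, and real and imaginary part both fall under
  \<open>real_moments_eq_0\<close>.\<close>

lemma fourier_eq_0:
  assumes f: "f \<in> L2" and 0: "\<And>n. fourier f n = 0"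
  shows "eq2 f (\<lambda>z. 0)"
proof -
  have [measurable]: "f \<in> borel_measurable borel" using f by simp
  have 1: "(\<lambda>z. 1) \<in> L2" by (rule L2_bounded[where C=1]) auto
  have int: "integrable circle f" using L2_integrable_mult[OF f 1] by simp
  have i1: "integrable circle (\<lambda>z. f z * z powi n)" for n
    using L2_integrable_mult[OF f e_in_L2[of n]] by (simp add: e_def)
  have i2: "integrable circle (\<lambda>z. cnj (f z) * z powi n)" for n
    using L2_integrable_mult[OF L2_cnj[OF f] e_in_L2[of n]] by (simp add: e_def)
  have m1: "(\<integral>z. f z * z powi n \<partial>circle) = 0" for n
    using 0[of "-n"] by (simp add: fourier_powi f)
  have m2: "(\<integral>z. cnj (f z) * z powi n \<partial>circle) = 0" for n
    using fourier_cnj[OF f, of "-n"] 0 by (simp add: fourier_powi f)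
  have "AE z in circle. Re (f z) = 0"
  proof (rule real_moments_eq_0)
    fix n :: int
    have "(\<integral>z. complex_of_real (Re (f z)) * z powi n \<partial>circle) =
        (\<integral>z. (f z * z powi n + cnj (f z) * z powi n) / 2 \<partial>circle)"
      by (intro Bochner_Integration.integral_cong)
        (auto simp: complex_eq_iff field_simps)
    also have "\<dots> = 0" using i1 i2 m1 m2 by simp
    finally show "(\<integral>z. complex_of_real (Re (f z)) * z powi n \<partial>circle) = 0" .
  qed (use int in simp)
  moreover have "AE z in circle. Im (f z) = 0"
  proof (rule real_moments_eq_0)
    fix n :: int
    have "(\<integral>z. complex_of_real (Im (f z)) * z powi n \<partial>circle) =
        (\<integral>z. (- \<i> / 2) * (f z * z powi n - cnj (f z) * z powi n) \<partial>circle)"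
      by (intro Bochner_Integration.integral_cong)
        (auto simp: complex_eq_iff field_simps)
    also have "\<dots> = 0" using i1 i2 m1 m2 by simp
    finally show "(\<integral>z. complex_of_real (Im (f z)) * z powi n \<partial>circle) = 0" .
  qed (use int in simp)
  ultimately show ?thesis
    unfolding eq2_def by eventually_elim (simp add: complex_eq_iff)
qed

text \<open>Only null functions are orthogonal to all \<open>e n\<close>. This is the induction
  principle for \<open>L2\<close>: a property defining a closed subspace is checked on the
  \<open>e n\<close> alone.\<close>

lemma L2_subset_closed_subspace:
  assumes K: "closed_subspace K" and "\<And>n. e n \<in> K"
  shows "L2 \<subseteq> K"
proof -
  have "K = L2"
  proof (rule closed_subspace_eqI[OF K closed_subspace_L2])
    fix f assume "f \<in> L2" and "\<And>g. g \<in> K \<Longrightarrow> inner2 f g = 0"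
    then show "eq2 f (\<lambda>z. 0)"
      using assms(2) by (intro fourier_eq_0) (auto simp: fourier_def)
  qed (use closed_subspaceD(1)[OF K] in auto)
  then show ?thesis by simp
qed

section \<open>The Hardy space and its orthogonal projection\<close>

lemma H2_L2: "f \<in> H2 \<Longrightarrow> f \<in> L2"
  by (simp add: H2_def)

lemma closed_subspace_H2: "closed_subspace H2"
proof -
  have "H2 = {f \<in> L2. \<forall>g\<in>e ` {..<0}. inner2 f g = 0}"
    by (auto simp: H2_def fourier_def)
  also have "closed_subspace \<dots>" by (rule closed_subspace_orth) auto
  finally show ?thesis .
qed

lemma e_in_H2: "n \<ge> 0 \<Longrightarrow> e n \<in> H2"
  by (auto simp: H2_def fourier_def inner2_e)

text \<open>Intersecting \<open>K\<close> with \<open>H2\<close> makes the coefficients at negative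
  indices vanish from the start, so only those at \<open>n \<ge> 0\<close> remain to be
  tested.\<close>

lemma H2_subset_closed_subspace:
  assumes K: "closed_subspace K" and "\<And>n. n \<ge> 0 \<Longrightarrow> e n \<in> K"
  shows "H2 \<subseteq> K"
proof -
  have "K \<inter> H2 = H2"
  proof (rule closed_subspace_eqI[OF closed_subspace_Int[OF K closed_subspace_H2] closed_subspace_H2])
    fix f assume f: "f \<in> H2" and "\<And>g. g \<in> K \<inter> H2 \<Longrightarrow> inner2 f g = 0"
    then have "fourier f n = 0" if "n \<ge> 0" for n
      using assms(2)[OF that] e_in_H2[OF that] by (simp add: fourier_def)
    moreover have "fourier f n = 0" if "n < 0" for n using f that by (simp add: H2_def)
    ultimately show "eq2 f (\<lambda>z. 0)"
      using f by (intro fourier_eq_0) (auto simp: H2_L2 not_le[symmetric])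
  qed auto
  then show ?thesis by blast
qed

lemma projH2:
  assumes "f \<in> L2"
  shows projH2_in: "projH2 f \<in> H2"
    and projH2_orth: "h \<in> H2 \<Longrightarrow> inner2 (\<lambda>z. f z - projH2 f z) h = 0"
proof -
  have "\<exists>g. g \<in> H2 \<and> (\<forall>h\<in>H2. inner2 (\<lambda>z. f z - g z) h = 0)"
    using L2_projection[OF closed_subspace_H2 assms] by blast
  from someI_ex[OF this]
  show "projH2 f \<in> H2" and "h \<in> H2 \<Longrightarrow> inner2 (\<lambda>z. f z - projH2 f z) h = 0"
    unfolding projH2_def by blast+
qed

lemma projH2_L2: "f \<in> L2 \<Longrightarrow> projH2 f \<in> L2"
  using projH2_in H2_L2 by blast

lemma inner2_projH2: "f \<in> L2 \<Longrightarrow> h \<in> H2 \<Longrightarrow> inner2 (projH2 f) h = inner2 f h"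
  using projH2_orth[of f h] by (simp add: inner2_diff_left projH2_L2 H2_L2)

text \<open>Test against \<open>h = f - g\<close>. Since \<open>projH2\<close> and \<open>Sa\<close>
  are chosen representatives, identities between their values hold only a.e. and are proved by this
  weak test.\<close>

lemma eq2_testI:
  assumes K: "closed_subspace K" and "f \<in> K" "g \<in> K" "\<And>h. h \<in> K \<Longrightarrow> inner2 f h = inner2 g h"
  shows "eq2 f g"
proof -
  note L2 = closed_subspaceD(1)[OF K]
  have "inner2 (\<lambda>z. f z - g z) h = 0" if "h \<in> K" for h
    using assms(2-4) that L2 by (simp add: inner2_diff_left)
  then have "eq2 (\<lambda>z. f z - g z) (\<lambda>z. 0)"
    using assms(2,3) closed_subspace_diff[OF K] L2 by (intro inner2_self_eq_0) auto
  then show ?thesis by (simp add: eq2_def)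
qed

lemma projH2_eqI:
  assumes "f \<in> L2" "g \<in> H2" "\<And>h. h \<in> H2 \<Longrightarrow> inner2 f h = inner2 g h"
  shows "eq2 (projH2 f) g"
  by (rule eq2_testI[OF closed_subspace_H2]) (use assms projH2_in inner2_projH2 in auto)

lemma norm2_projH2_le: 
  assumes "f \<in> L2" shows "norm2 (projH2 f) \<le> norm2 f"
proof -
  have "(norm2 (projH2 f))\<^sup>2 = cmod (inner2 (projH2 f) (projH2 f))"
    by (simp only: inner2_self norm_of_real) simp
  also have "\<dots> = cmod (inner2 f (projH2 f))"
    using inner2_projH2[OF assms projH2_in[OF assms]] by simp
  also have "\<dots> \<le> norm2 f * norm2 (projH2 f)"
    by (intro inner2_CS assms projH2_L2)
  finally have "norm2 (projH2 f) * norm2 (projH2 f) \<le> norm2 f * norm2 (projH2 f)"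
    by (simp add: power2_eq_square)
  then show ?thesis
    by (cases "norm2 (projH2 f) = 0") (auto simp: mult_le_cancel_right order.strict_iff_order)
qed

section \<open>Multiplication by an inner function\<close>

text \<open>The base is a parameter because division by \<open>b\<close> and division by
  \<open>z\<close> both occur; for base \<open>z\<close> this is a power of the bilateral
  shift.\<close>

definition powmult :: "cfun \<Rightarrow> int \<Rightarrow> cfun \<Rightarrow> cfun" where
  "powmult u n f = (\<lambda>z. u z powi n * f z)"

locale inner_fun =
  fixes b :: cfun
  assumes inner_b: "inner_function b"
begin

lemma b_measurable [simp]: "b \<in> borel_measurable borel"
  using inner_b by (simp add: inner_function_def Hinf_def Linf_def)

lemma AE_cmod_b: "AE z in circle. cmod (b z) = 1"
  using inner_b by (simp add: inner_function_def)

lemma b_H2: "b \<in> H2"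
proof -
  have "b \<in> L2"
    by (rule L2_bounded[where C=1]) (use AE_cmod_b in \<open>auto intro: eventually_mono\<close>)
  then show ?thesis using inner_b by (simp add: inner_function_def Hinf_def H2_def)
qed

lemma powi_b_measurable [simp]: "(\<lambda>z. b z powi n) \<in> borel_measurable borel"
  using measurable_compose[OF b_measurable measurable_powi] .

lemma AE_cmod_powi: "AE z in circle. cmod (b z powi n) = 1"
  using AE_cmod_b by eventually_elim (simp add: norm_power_int)

lemma AE_cnj_powi_b: "AE z in circle. cnj (b z powi n) = b z powi (- n)"
  using AE_cmod_b
proof eventually_elim
  case (elim z)
  then have "cnj (b z) = inverse (b z)" by (simp add: inverse_complex_def complex_eq_iff cmod_def)
  then show ?case by (simp add: power_int_minus power_int_inverse)
qed

lemma powmult_L2 [simp]: "f \<in> L2 \<Longrightarrow> powmult b n f \<in> L2"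
  unfolding powmult_def
  by (rule L2_mult_bounded[where C=1]) (use AE_cmod_powi[of n] in \<open>auto intro: eventually_mono\<close>)

lemma powmult_0 [simp]: "powmult b 0 f = f"
  by (simp add: powmult_def)

text \<open>Only a.e., since the law of exponents for integer powers can fail at points where
  \<open>b z = 0\<close>.\<close>

lemma powmult_powmult: "eq2 (powmult b m (powmult b n f)) (powmult b (m + n) f)"
  unfolding eq2_def powmult_def using AE_cmod_b
proof eventually_elim
  case (elim z)
  then have "b z \<noteq> 0" by auto
  then show ?case by (simp add: power_int_add)
qed

lemma powmult_cong: "eq2 f g \<Longrightarrow> eq2 (powmult b n f) (powmult b n g)"
  unfolding eq2_def powmult_def by (erule eventually_mono) simp

lemma powmult_closed_subspace:
  assumes "closed_subspace K" "f \<in> L2" "powmult b (m + n) f \<in> K"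
  shows "powmult b m (powmult b n f) \<in> K"
  by (rule closed_subspace_eq2[OF assms(1,3)]) (use assms(2) powmult_powmult in auto)

lemma inner2_powmult:
  assumes "f \<in> L2" "g \<in> L2"
  shows "inner2 (powmult b n f) g = inner2 f (powmult b (- n) g)"
  unfolding inner2_def
proof (rule integral_cong_AE)
  note b_measurable [measurable] powi_b_measurable [measurable]
  show "AE z in circle. powmult b n f z * cnj (g z) = f z * cnj (powmult b (- n) g z)"
    using AE_cnj_powi_b[of "-n"] by eventually_elim (simp add: powmult_def)
  show "(\<lambda>z. powmult b n f z * cnj (g z)) \<in> borel_measurable circle"
      "(\<lambda>z. f z * cnj (powmult b (- n) g z)) \<in> borel_measurable circle"
    using assms by (simp_all add: powmult_def)
qed

lemma norm2_powmult:
  assumes "f \<in> L2" shows "norm2 (powmult b n f) = norm2 f"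
proof (rule power2_eq_imp_eq)
  have "inner2 (powmult b n f) (powmult b n f) = inner2 f (powmult b (- n) (powmult b n f))"
    using assms by (simp add: inner2_powmult)
  also have "\<dots> = inner2 f f"
    using assms powmult_powmult[of "-n" n f] by (intro inner2_cong) auto
  finally show "(norm2 (powmult b n f))\<^sup>2 = (norm2 f)\<^sup>2" by (simp add: norm2_sq_Re)
qed auto

end

text \<open>The coordinate function is \<open>e 1\<close> and is itself inner, so the facts about
  powers of \<open>b\<close> specialize to the shift through the interpretation
  \<open>Z\<close>.\<close>

lemma inner_fun_id: "inner_fun (\<lambda>z. z)"
proof
  have "(\<lambda>z. z) = e 1" by (simp add: e_def)
  then have "fourier (\<lambda>z. z) n = 0" if "n < 0" for n
    using that by (simp add: fourier_def inner2_e)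
  moreover have "\<exists>C. AE z in circle. cmod z \<le> C"
    using AE_circle_cmod by (intro exI[of _ 1]) (auto intro: eventually_mono)
  ultimately show "inner_function (\<lambda>z. z)"
    using AE_circle_cmod by (simp add: inner_function_def Hinf_def Linf_def)
qed

interpretation Z: inner_fun "\<lambda>z. z"
  by (rule inner_fun_id)

lemma fourier_shift:
  assumes "f \<in> L2" shows "fourier (powmult (\<lambda>z. z) k f) n = fourier f (n - k)"
proof -
  have "fourier (powmult (\<lambda>z. z) k f) n = inner2 f (powmult (\<lambda>z. z) (- k) (e n))"
    unfolding fourier_def using assms by (simp add: Z.inner2_powmult)
  also have "\<dots> = fourier f (n - k)"
    unfolding fourier_def
  proof (rule inner2_cong)
    have "e m = powmult (\<lambda>z. z) m (\<lambda>_. 1)" for m by (simp add: e_def powmult_def)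
    then show "eq2 (powmult (\<lambda>z. z) (- k) (e n)) (e (n - k))"
      using Z.powmult_powmult[of "-k" n "\<lambda>_. 1"] by simp
  qed (use assms in auto)
  finally show ?thesis .
qed

section \<open>Multiplication by \<open>b\<close> on the Hardy space\<close>

context inner_fun
begin

text \<open>Moving the power across the inner product turns the condition into orthogonality to
  \<open>powmult b (- k) (e n)\<close> for \<open>n < 0\<close>. For \<open>k = -1\<close> the set
  is \<open>b H2\<close> up to a.e. equality.\<close>

lemma closed_subspace_powmult_H2: "closed_subspace {f \<in> L2. powmult b k f \<in> H2}"
proof -
  have "{f \<in> L2. powmult b k f \<in> H2} = {f \<in> L2. \<forall>g \<in> (\<lambda>n. powmult b (- k) (e n)) ` {..<0}. inner2 f g = 0}"
    by (auto simp: H2_def fourier_def inner2_powmult)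
  also have "closed_subspace \<dots>" by (rule closed_subspace_orth) auto
  finally show ?thesis .
qed

text \<open>For \<open>n \<ge> 0\<close>, \<open>b\<close> times \<open>e n\<close> is
  \<open>b\<close> shifted up by \<open>n\<close>, which stays in \<open>H2\<close>; density of
  these \<open>e n\<close> does the rest.\<close>

lemma powmult_1_H2:
  assumes "f \<in> H2" shows "powmult b 1 f \<in> H2"
proof -
  have "H2 \<subseteq> {f \<in> L2. powmult b 1 f \<in> H2}"
  proof (rule H2_subset_closed_subspace[OF closed_subspace_powmult_H2])
    fix n :: int assume n: "n \<ge> 0"
    have "powmult b 1 (e n) = powmult (\<lambda>z. z) n b" by (simp add: powmult_def e_def mult.commute)
    moreover have "powmult (\<lambda>z. z) n b \<in> H2"
      using b_H2 n by (simp add: H2_def fourier_shift)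
    ultimately show "e n \<in> {f \<in> L2. powmult b 1 f \<in> H2}" by simp
  qed
  with assms show ?thesis by blast
qed

lemma powmult_H2:
  assumes "f \<in> H2" "n \<ge> 0" shows "powmult b n f \<in> H2"
  using assms(2)
proof (induction n rule: int_ge_induct)
  case (step n)
  have "powmult b (n + 1) f \<in> L2" using assms(1) by (simp add: H2_L2)
  then show ?case
    by (rule closed_subspace_eq2[OF closed_subspace_H2 powmult_1_H2[OF step.IH]])
      (metis powmult_powmult eq2_sym add.commute)
qed (use assms in simp)

text \<open>The coefficient at 0 is the value at the origin of the holomorphic extension, which
  explains multiplicativity. It is verified on \<open>e n\<close>: for \<open>n > 0\<close> both
  sides are 0.\<close>

lemma fourier_0_powmult_1:
  assumes "f \<in> H2" shows "fourier (powmult b 1 f) 0 = fourier b 0 * fourier f 0"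
proof -
  \<comment> \<open>\<open>g\<close> represents the functional sending \<open>f\<close> to
    \<open>fourier (powmult b 1 f) 0 - fourier b 0 * fourier f 0\<close>, so the claim becomes
    orthogonality to one vector, a closed condition.\<close>
  define g where "g z = powmult b (-1) (e 0) z - cnj (fourier b 0) * e 0 z" for z
  have g: "inner2 f g = fourier (powmult b 1 f) 0 - fourier b 0 * fourier f 0" if "f \<in> L2" for f
    using that unfolding g_def fourier_def
    by (simp add: inner2_diff_right inner2_scale_right inner2_powmult)
  have gL2: "g \<in> L2" unfolding g_def by simp
  have "H2 \<subseteq> {f \<in> L2. \<forall>h\<in>{g}. inner2 f h = 0}"
  proof (rule H2_subset_closed_subspace[OF closed_subspace_orth])
    fix n :: int assume n: "n \<ge> 0"
    have "powmult b 1 (e n) = powmult (\<lambda>z. z) n b" by (simp add: powmult_def e_def mult.commute)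
    then have "fourier (powmult b 1 (e n)) 0 = fourier b (- n)"
      using b_H2 by (simp add: fourier_shift H2_L2)
    also have "\<dots> = fourier b 0 * fourier (e n) 0"
      using b_H2 n by (auto simp: fourier_def[of "e n"] inner2_e H2_def)
    finally show "e n \<in> {f \<in> L2. \<forall>h\<in>{g}. inner2 f h = 0}" by (simp add: g)
  qed (use gL2 in auto)
  then show ?thesis using assms g[of f] by (auto simp: H2_L2)
qed

lemma fourier_cong: "eq2 f g \<Longrightarrow> f \<in> L2 \<Longrightarrow> g \<in> L2 \<Longrightarrow> fourier f n = fourier g n"
  unfolding fourier_def by (intro inner2_cong) auto

lemma fourier_0_powmult:
  assumes "f \<in> H2" shows "fourier (powmult b (int n) f) 0 = fourier b 0 ^ n * fourier f 0"
proof (induction n)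
  case (Suc n)
  have "fourier (powmult b (int (Suc n)) f) 0 = fourier (powmult b 1 (powmult b (int n) f)) 0"
    using powmult_powmult[of 1 "int n" f] assms by (intro fourier_cong) (auto simp: H2_L2 eq2_sym)
  then show ?case
    using Suc powmult_H2[OF assms, of "int n"] by (simp add: fourier_0_powmult_1)
qed simp

text \<open>The constant \<open>c = fourier b 0\<close> is the projection of the unit vector
  \<open>b\<close> onto the constants, so \<open>b - c\<close> has squared norm
  \<open>1 - |c|^2\<close>, and \<open>|c| = 1\<close> would make \<open>b\<close> constant.\<close>

lemma cmod_fourier_0_less_1:
  assumes "nonconstant b" shows "cmod (fourier b 0) < 1"
proof -
  define c where "c = fourier b 0"
  have bL2: "b \<in> L2" using b_H2 H2_L2 by blast
  have 1: "(\<lambda>z. 1) \<in> L2" "norm2 (\<lambda>z. 1) = 1"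
    by (auto simp: norm2_def intro: L2_bounded[where C=1])
  have nb: "norm2 b = 1"
    using norm2_powmult[OF 1(1), of 1] 1(2) by (simp add: powmult_def)
  have c1: "c = inner2 b (\<lambda>z. 1)" by (simp add: c_def fourier_def e_def)
  have "Re (inner2 b (\<lambda>z. c * 1)) = (cmod c)\<^sup>2"
    unfolding inner2_scale_right c1[symmetric] cmod_power2 by (simp add: power2_eq_square)
  moreover have "norm2 (\<lambda>z. c * 1) = cmod c" using norm2_scale[of c "\<lambda>z. 1"] 1 by simp
  ultimately have eq: "(norm2 (\<lambda>z. b z - c * 1))\<^sup>2 = 1 - (cmod c)\<^sup>2"
    using norm2_diff_sq[OF bL2 L2_scale[OF 1(1)], of c] nb by simp
  have "cmod c \<le> 1" using inner2_CS[OF bL2 1(1)] nb 1(2) by (simp add: c1)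
  moreover have "cmod c \<noteq> 1"
  proof
    assume "cmod c = 1"
    then have "norm2 (\<lambda>z. b z - c * 1) = 0" using eq by simp
    then have "eq2 b (\<lambda>z. c * 1)"
      using eq2_iff_norm2[OF bL2 L2_scale[OF 1(1)]] by blast
    then show False using assms by (auto simp: nonconstant_def)
  qed
  ultimately show ?thesis by (simp add: c_def)
qed

text \<open>The intersection of the subspaces \<open>b\<^sup>n H\<^sup>2\<close> is zero. It is stable under division by
  \<open>b\<close>, and \<open>fourier f 0\<close> vanishes on it because \<open>cmod (fourier b 0) < 1\<close>; so it
  is stable under division by \<open>z\<close> as well, and all Fourier coefficients vanish on it.\<close>

definition tail :: "cfun set" where
  "tail = {f \<in> L2. \<forall>n::nat. powmult b (- int n) f \<in> H2}"

lemma tail_powmult: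
  assumes "f \<in> tail" shows "powmult b (- int m) f \<in> tail"
  using assms unfolding tail_def
proof (intro CollectI conjI allI)
  fix n assume f: "f \<in> {f \<in> L2. \<forall>n::nat. powmult b (- int n) f \<in> H2}"
  then have "powmult b (- int (n + m)) f \<in> H2" by blast
  then have "powmult b (- int n + - int m) f \<in> H2" by (simp add: algebra_simps)
  with f show "powmult b (- int n) (powmult b (- int m) f) \<in> H2"
    by (intro powmult_closed_subspace[OF closed_subspace_H2]) auto
qed auto

text \<open>Writing \<open>f\<close> as \<open>b^n\<close> times some \<open>g \<in> H2\<close> of
  the same norm, multiplicativity at 0 bounds the coefficient by \<open>|c|^n * norm2 f\<close>, for
  every \<open>n\<close>.\<close>

lemma tail_fourier_0:
  assumes "nonconstant b" "f \<in> tail" shows "fourier f 0 = 0"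
proof -
  define c where "c = fourier b 0"
  have f: "f \<in> L2" "\<And>n::nat. powmult b (- int n) f \<in> H2" using assms(2) by (auto simp: tail_def)
  have bound: "cmod (fourier f 0) \<le> cmod c ^ n * norm2 f" for n
  proof -
    define g where "g = powmult b (- int n) f"
    have g: "g \<in> H2" "g \<in> L2" "norm2 g = norm2 f"
      using f by (auto simp: g_def norm2_powmult)
    have "eq2 f (powmult b (int n) g)"
      using powmult_powmult[of "int n" "- int n" f] by (simp add: g_def eq2_sym)
    then have "fourier f 0 = fourier (powmult b (int n) g) 0"
      using f g by (intro fourier_cong) auto
    also have "\<dots> = c ^ n * fourier g 0" using g by (simp add: fourier_0_powmult c_def)
    finally have "cmod (fourier f 0) = cmod c ^ n * cmod (fourier g 0)"
      by (simp add: norm_mult norm_power)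
    also have "cmod (fourier g 0) \<le> norm2 g * norm2 (e 0)"
      unfolding fourier_def using g by (intro inner2_CS) auto
    also have "norm2 (e 0) = 1" by (simp add: e_def norm2_def)
    finally show ?thesis using g(3) by (simp add: mult_left_mono)
  qed
  have "(\<lambda>n. cmod c ^ n * norm2 f) \<longlonglongrightarrow> 0"
    using cmod_fourier_0_less_1[OF assms(1)] by (intro tendsto_mult_left_zero LIMSEQ_power_zero) (simp add: c_def)
  then have "cmod (fourier f 0) \<le> 0" by (rule LIMSEQ_le_const) (use bound in auto)
  then show ?thesis by simp
qed

lemma tail_eq_0:
  assumes "nonconstant b" "f \<in> tail" shows "eq2 f (\<lambda>z. 0)"
proof -
  have shift: "powmult (\<lambda>z. z) (-1) g \<in> tail" if g: "g \<in> tail" for g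
    unfolding tail_def
  proof (intro CollectI conjI allI)
    show "powmult (\<lambda>z. z) (-1) g \<in> L2" using g by (simp add: tail_def)
    fix n :: nat
    \<comment> \<open>\<open>h\<close> lies in \<open>tail\<close> as well, so its coefficient at 0
      vanishes; that is what keeps \<open>h\<close> in \<open>H2\<close> after division by
      \<open>z\<close>.\<close>
    define h where "h = powmult b (- int n) g"
    have h: "h \<in> H2" "fourier h 0 = 0"
      using g tail_fourier_0[OF assms(1) tail_powmult[OF g]] by (auto simp: h_def tail_def)
    have "powmult b (- int n) (powmult (\<lambda>z. z) (-1) g) = powmult (\<lambda>z. z) (-1) h"
      by (simp add: h_def powmult_def fun_eq_iff)
    moreover have "powmult (\<lambda>z. z) (-1) h \<in> H2"
    proof -
      have "fourier h (n + 1) = 0" if "n < 0" for n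
        using h that by (cases "n = -1") (auto simp: H2_def)
      with h(1) show ?thesis by (simp add: H2_def fourier_shift)
    qed
    ultimately show "powmult b (- int n) (powmult (\<lambda>z. z) (-1) g) \<in> H2" by simp
  qed
  have f: "f \<in> L2" using assms(2) by (simp add: tail_def)
  have coeff: "fourier g (int n) = 0" if "g \<in> tail" for n g
    using that
  proof (induction n arbitrary: g)
    case (Suc n)
    have "fourier (powmult (\<lambda>z. z) (-1) g) (int n) = 0" by (rule Suc.IH[OF shift[OF Suc.prems]])
    then show ?case using Suc.prems by (simp add: fourier_shift tail_def add.commute)
  qed (simp add: tail_fourier_0[OF assms(1)])
  show ?thesis
  proof (rule fourier_eq_0[OF f])
    fix n :: int
    show "fourier f n = 0"
    proof (cases "n < 0")
      case True
      have "f \<in> H2" using assms(2) by (auto simp: tail_def dest: spec[of _ 0])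
      with True show ?thesis by (simp add: H2_def)
    next
      case False
      then show ?thesis using coeff[OF assms(2), of "nat n"] by simp
    qed
  qed
qed

section \<open>The wandering subspace and the Wold argument\<close>

lemma Dspace_iff: "f \<in> Dspace b \<longleftrightarrow> f \<in> H2 \<and> (\<forall>g\<in>H2. inner2 f (powmult b 1 g) = 0)"
  by (simp add: Dspace_def powmult_def)

text \<open>Let \<open>q\<close> be the projection of \<open>p\<close> onto \<open>b H2\<close>.
  Then \<open>p - q\<close> lies in \<open>Dspace b\<close>, so it is orthogonal to \<open>p\<close>
  by hypothesis and to \<open>q\<close> by construction, hence to itself.\<close>

lemma H2_orth_Dspace:
  assumes p: "p \<in> H2" and orth: "\<And>d. d \<in> Dspace b \<Longrightarrow> inner2 p d = 0"
  shows "powmult b (-1) p \<in> H2"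
proof -
  define B where "B = {f \<in> L2. powmult b (-1) f \<in> H2}"
  have B: "closed_subspace B" unfolding B_def by (rule closed_subspace_powmult_H2)
  have BH: "f \<in> H2" if "f \<in> B" for f
  proof (rule closed_subspace_eq2[OF closed_subspace_H2])
    show "powmult b 1 (powmult b (-1) f) \<in> H2" using that by (intro powmult_1_H2) (simp add: B_def)
    show "eq2 f (powmult b 1 (powmult b (-1) f))"
      using powmult_powmult[of 1 "-1" f] by (simp add: eq2_sym)
  qed (use that in \<open>simp add: B_def\<close>)
  have HB: "powmult b 1 g \<in> B" if "g \<in> H2" for g
    unfolding B_def using that powmult_closed_subspace[OF closed_subspace_H2, of g "-1" 1]
    by (simp add: H2_L2)
  obtain q where q: "q \<in> B" "\<And>h. h \<in> B \<Longrightarrow> inner2 (\<lambda>z. p z - q z) h = 0"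
    using L2_projection[OF B H2_L2[OF p]] by blast
  have L2: "p \<in> L2" "q \<in> L2" using p q(1) by (auto simp: H2_L2 B_def)
  have d: "(\<lambda>z. p z - q z) \<in> Dspace b"
    unfolding Dspace_iff using q HB BH p closed_subspace_diff[OF closed_subspace_H2] by blast
  have "inner2 q (\<lambda>z. p z - q z) = 0" using q inner2_cnj[of "\<lambda>z. p z - q z" q] by simp
  then have "inner2 (\<lambda>z. p z - q z) (\<lambda>z. p z - q z) = 0"
    using orth[OF d] L2 by (simp add: inner2_diff_left)
  then have "eq2 p q" using inner2_self_eq_0[of "\<lambda>z. p z - q z"] L2 by (simp add: eq2_def)
  then have "p \<in> B" using closed_subspace_eq2[OF B q(1) L2(1)] by blast
  then show ?thesis by (simp add: B_def)
qed

text \<open>If \<open>f\<close> is orthogonal to every \<open>b\<^sup>n \<D>\<close>, then \<open>P f = b P (b\<^sup>-\<^sup>1 f)\<close>, and iterating puts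
  \<open>P f\<close> into the tail, so \<open>P f = 0\<close>. The same holds for all \<open>b\<^sup>n f\<close>, which puts the conjugate of
  \<open>f\<close> into the tail.\<close>

lemma wandering_projH2:
  assumes f: "f \<in> L2" and orth: "\<And>n d. d \<in> Dspace b \<Longrightarrow> inner2 (powmult b n f) d = 0"
  shows "powmult b (-1) (projH2 f) \<in> H2"
    and "eq2 (projH2 (powmult b (-1) f)) (powmult b (-1) (projH2 f))"
proof -
  show H: "powmult b (-1) (projH2 f) \<in> H2"
  proof (rule H2_orth_Dspace[OF projH2_in[OF f]])
    fix d assume d: "d \<in> Dspace b"
    then have "d \<in> H2" by (simp add: Dspace_iff)
    then show "inner2 (projH2 f) d = 0" using orth[OF d, of 0] f by (simp add: inner2_projH2)
  qed
  show "eq2 (projH2 (powmult b (-1) f)) (powmult b (-1) (projH2 f))"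
  proof (rule projH2_eqI[OF _ H])
    fix h assume h: "h \<in> H2"
    then show "inner2 (powmult b (-1) f) h = inner2 (powmult b (-1) (projH2 f)) h"
      using f by (simp add: inner2_powmult H2_L2 projH2_L2 inner2_projH2 powmult_1_H2)
  qed (use f in simp)
qed

lemma wandering_orth_H2:
  assumes nc: "nonconstant b" and f: "f \<in> L2"
    and orth: "\<And>n d. d \<in> Dspace b \<Longrightarrow> inner2 (powmult b n f) d = 0"
  shows "eq2 (projH2 f) (\<lambda>z. 0)"
proof (rule tail_eq_0[OF nc])
  \<comment> \<open>The iteration applies \<open>wandering_projH2\<close> to
    \<open>powmult b (- n) f\<close> in place of \<open>f\<close>; the hypothesis survives because
    it covers all integer powers.\<close>
  have orth': "inner2 (powmult b n (powmult b m f)) d = 0" if "d \<in> Dspace b" for m n d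
  proof -
    have "d \<in> L2" using that by (simp add: Dspace_iff H2_L2)
    then have "inner2 (powmult b n (powmult b m f)) d = inner2 (powmult b (n + m) f) d"
      using f powmult_powmult by (intro inner2_cong) auto
    with orth[OF that] show ?thesis by simp
  qed
  have step: "eq2 (powmult b (- int n) (projH2 f)) (projH2 (powmult b (- int n) f))" for n
  proof (induction n)
    case (Suc n)
    have "eq2 (powmult b (- int (Suc n)) (projH2 f)) (powmult b (-1) (powmult b (- int n) (projH2 f)))"
      using powmult_powmult[of "-1" "- int n" "projH2 f"] by (simp add: eq2_sym)
    also have "eq2 \<dots> (powmult b (-1) (projH2 (powmult b (- int n) f)))"
      by (rule powmult_cong[OF Suc])
    also have "eq2 \<dots> (projH2 (powmult b (-1) (powmult b (- int n) f)))"
      using wandering_projH2(2)[of "powmult b (- int n) f"] f orth' by (auto intro: eq2_sym)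
    also have "eq2 \<dots> (projH2 (powmult b (- int (Suc n)) f))"
    proof (rule projH2_eqI)
      fix h assume h: "h \<in> H2"
      have "inner2 (powmult b (-1) (powmult b (- int n) f)) h = inner2 (powmult b (- int (Suc n)) f) h"
        using f h powmult_powmult[of "-1" "- int n" f] by (intro inner2_cong) (auto simp: H2_L2)
      also have "\<dots> = inner2 (projH2 (powmult b (- int (Suc n)) f)) h"
        using f h by (intro inner2_projH2[symmetric] powmult_L2)
      finally show "inner2 (powmult b (-1) (powmult b (- int n) f)) h
          = inner2 (projH2 (powmult b (- int (Suc n)) f)) h" .
    qed (use f projH2_in powmult_L2 in blast)+
    finally show ?case .
  qed simp
  show "projH2 f \<in> tail"
    unfolding tail_def
  proof (intro CollectI conjI allI)
    show "powmult b (- int n) (projH2 f) \<in> H2" for n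
      by (rule closed_subspace_eq2[OF closed_subspace_H2 _ _ step])
        (use f in \<open>simp_all add: projH2_in projH2_L2\<close>)
  qed (use f projH2_L2 in blast)
qed

theorem wandering_eq_0:
  assumes nc: "nonconstant b" and f: "f \<in> L2"
    and orth: "\<And>n d. d \<in> Dspace b \<Longrightarrow> inner2 (powmult b n f) d = 0"
  shows "eq2 f (\<lambda>z. 0)"
proof -
  have perp: "inner2 (powmult b n f) h = 0" if "h \<in> H2" for n h
  proof -
    have "eq2 (projH2 (powmult b n f)) (\<lambda>z. 0)"
    proof (rule wandering_orth_H2[OF nc])
      fix m d assume d: "d \<in> Dspace b"
      then have "d \<in> L2" by (simp add: Dspace_iff H2_L2)
      then have "inner2 (powmult b m (powmult b n f)) d = inner2 (powmult b (m + n) f) d"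
        using f powmult_powmult by (intro inner2_cong) auto
      with orth[OF d] show "inner2 (powmult b m (powmult b n f)) d = 0" by simp
    qed (use f in simp)
    then have "inner2 (projH2 (powmult b n f)) h = inner2 (\<lambda>z. 0) h"
      using f that by (intro inner2_cong) (auto simp: projH2_L2 H2_L2)
    then show ?thesis using f that by (simp add: inner2_projH2)
  qed
  have "(\<lambda>z. cnj (f z)) \<in> tail"
    unfolding tail_def
  proof (intro CollectI conjI allI)
    fix n :: nat
    \<comment> \<open>The coefficient of a conjugate at a negative index is the conjugate of the
      coefficient of \<open>powmult b n f\<close> at the opposite, positive index, and
      \<open>perp\<close> makes that one vanish.\<close>
    have "(\<lambda>z. cnj (powmult b (int n) f z)) \<in> H2"
      using f perp[OF e_in_H2, of "- _" "int n"] by (auto simp: H2_def fourier_cnj fourier_def[of "powmult b (int n) f"])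
    moreover have "eq2 (powmult b (- int n) (\<lambda>z. cnj (f z))) (\<lambda>z. cnj (powmult b (int n) f z))"
      unfolding eq2_def powmult_def using AE_cnj_powi_b[of "int n"] by eventually_elim simp
    ultimately show "powmult b (- int n) (\<lambda>z. cnj (f z)) \<in> H2"
      by (rule closed_subspace_eq2[OF closed_subspace_H2 _ powmult_L2[OF L2_cnj[OF f]]])
  qed (use f in simp)
  then have "eq2 (\<lambda>z. cnj (f z)) (\<lambda>z. 0)" by (rule tail_eq_0[OF nc])
  then show ?thesis by (simp add: eq2_def)
qed

end

section \<open>The Cuntz family\<close>

lemma orthonormal_basis_subset:
  assumes onb: "orthonormal_basis I v V" and "V \<subseteq> L2" and K: "closed_subspace K"
    and v: "\<And>i. i \<in> I \<Longrightarrow> v i \<in> K"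
  shows "V \<subseteq> K"
proof
  fix f assume f: "f \<in> V"
  have "\<exists>F c. finite F \<and> F \<subseteq> I \<and> norm2 (\<lambda>z. f z - (\<Sum>i\<in>F. c i * v i z)) < inverse (Suc n)" for n
    using onb f unfolding orthonormal_basis_def by (auto simp del: of_nat_Suc)
  then obtain F c where F: "\<And>n. F n \<subseteq> I"
      "\<And>n. norm2 (\<lambda>z. f z - (\<Sum>i\<in>F n. c n i * v i z)) < inverse (Suc n)"
    by metis
  show "f \<in> K"
  proof (rule closed_subspaceD(4)[OF K])
    show "f \<in> L2" using f assms(2) by blast
    show "(\<lambda>z. \<Sum>i\<in>F n. c n i * v i z) \<in> K" for n
      using F(1)[of n] v by (intro closed_subspace_sum[OF K] closed_subspace_scale[OF K]) auto
    show "(\<lambda>n. norm2 (\<lambda>z. f z - (\<Sum>i\<in>F n. c n i * v i z))) \<longlonglongrightarrow> 0"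
    proof (rule tendsto_sandwich[OF _ _ tendsto_const LIMSEQ_inverse_real_of_nat])
      show "\<forall>\<^sub>F n in sequentially. norm2 (\<lambda>z. f z - (\<Sum>i\<in>F n. c n i * v i z)) \<le> inverse (real (Suc n))"
        using F(2) by (intro always_eventually allI less_imp_le)
    qed auto
  qed
qed

lemma adjoint_unique:
  assumes K: "closed_subspace K" and A: "\<And>f. f \<in> K \<Longrightarrow> A f \<in> K"
    and adj: "is_adjoint K A B" "is_adjoint K A C" and f: "f \<in> K"
  shows "eq2 (B f) (C f)"
proof (rule eq2_testI[OF K])
  have BC: "bounded_op K B" "bounded_op K C"
      "\<And>h. h \<in> K \<Longrightarrow> inner2 (A h) f = inner2 h (B f)" "\<And>h. h \<in> K \<Longrightarrow> inner2 (A h) f = inner2 h (C f)"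
    using adj f unfolding is_adjoint_def by auto
  then show "B f \<in> K" "C f \<in> K" using f unfolding bounded_op_def by auto
  fix h assume "h \<in> K"
  then have "inner2 h (B f) = inner2 h (C f)" using BC(3,4) by metis
  then show "inner2 (B f) h = inner2 (C f) h" using inner2_cnj by metis
qed

text \<open>Linearity and the norm bounds let agreement pass to linear combinations and limits.
  Applied to the \<open>e n\<close>, this gives uniqueness of the family.\<close>

lemma bounded_op_agree:
  assumes A: "bounded_op L2 A" and B: "bounded_op L2 B"
  shows "closed_subspace {f \<in> L2. eq2 (A f) (B f)}"
proof (rule closed_subspaceI)
  have L2: "A f \<in> L2" "B f \<in> L2" if "f \<in> L2" for f
    using A B that unfolding bounded_op_def by blast+
  have lin: "eq2 (A (\<lambda>z. a * f z + c * g z)) (\<lambda>z. a * A f z + c * A g z)"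
      "eq2 (B (\<lambda>z. a * f z + c * g z)) (\<lambda>z. a * B f z + c * B g z)" if "f \<in> L2" "g \<in> L2" for f g a c
    using A B that unfolding bounded_op_def by blast+
  have diff: "eq2 (A (\<lambda>z. f z - g z)) (\<lambda>z. A f z - A g z)"
      "eq2 (B (\<lambda>z. f z - g z)) (\<lambda>z. B f z - B g z)" if "f \<in> L2" "g \<in> L2" for f g
    using lin[OF that, of 1 "-1"] by simp_all
  obtain C where C: "\<And>f. f \<in> L2 \<Longrightarrow> norm2 (A f) \<le> C * norm2 f"
    using A unfolding bounded_op_def by blast
  obtain D where D: "\<And>f. f \<in> L2 \<Longrightarrow> norm2 (B f) \<le> D * norm2 f"
    using B unfolding bounded_op_def by blast
  {
    have "eq2 (A (\<lambda>z. 0)) (\<lambda>z. 0)" "eq2 (B (\<lambda>z. 0)) (\<lambda>z. 0)"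
      using lin[of "\<lambda>z. 0" "\<lambda>z. 0" 0 0] by simp_all
    then have "eq2 (A (\<lambda>z. 0)) (B (\<lambda>z. 0))" by (blast intro: eq2_trans eq2_sym)
    then show "(\<lambda>z. 0) \<in> {f \<in> L2. eq2 (A f) (B f)}" by simp
  next
    fix f g a c assume fg: "f \<in> {f \<in> L2. eq2 (A f) (B f)}" "g \<in> {f \<in> L2. eq2 (A f) (B f)}"
    then have "eq2 (\<lambda>z. a * A f z + c * A g z) (\<lambda>z. a * B f z + c * B g z)"
      unfolding eq2_def by auto
    then have "eq2 (A (\<lambda>z. a * f z + c * g z)) (B (\<lambda>z. a * f z + c * g z))"
      using lin[of f g a c] fg by (blast intro: eq2_trans eq2_sym)
    with fg show "(\<lambda>z. a * f z + c * g z) \<in> {f \<in> L2. eq2 (A f) (B f)}" by simp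
  next
    fix f u assume f: "f \<in> L2" and u: "\<And>n. u n \<in> {f \<in> L2. eq2 (A f) (B f)}"
      and lim: "(\<lambda>n. norm2 (\<lambda>z. f z - u n z)) \<longlonglongrightarrow> 0"
    have uL2: "u n \<in> L2" and ueq: "eq2 (A (u n)) (B (u n))" for n using u[of n] by auto
    have "norm2 (\<lambda>z. A f z - B f z) \<le> (C + D) * norm2 (\<lambda>z. f z - u n z)" for n
    proof -
      note m = f uL2[of n] L2[OF f] L2[OF uL2[of n]]
      have "norm2 (\<lambda>z. A f z - B f z) \<le> norm2 (\<lambda>z. A f z - A (u n) z) + norm2 (\<lambda>z. A (u n) z - B f z)"
        by (rule norm2_triangle_diff) (use m in auto)
      also have "norm2 (\<lambda>z. A f z - A (u n) z) = norm2 (A (\<lambda>z. f z - u n z))"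
        using diff(1)[OF m(1,2)] L2(1)[OF L2_diff[OF m(1,2)]] m by (intro norm2_cong) (auto intro: eq2_sym)
      also have "norm2 (\<lambda>z. A (u n) z - B f z) = norm2 (\<lambda>z. B (u n) z - B f z)"
      proof (rule norm2_cong)
        show "eq2 (\<lambda>z. A (u n) z - B f z) (\<lambda>z. B (u n) z - B f z)"
          using ueq[of n] unfolding eq2_def by (rule eventually_mono) simp
      qed (use m in auto)
      also have "norm2 (\<lambda>z. B (u n) z - B f z) = norm2 (\<lambda>z. B f z - B (u n) z)"
        by (rule norm2_minus_commute)
      also have "\<dots> = norm2 (B (\<lambda>z. f z - u n z))"
        using diff(2)[OF m(1,2)] L2(2)[OF L2_diff[OF m(1,2)]] m by (intro norm2_cong) (auto intro: eq2_sym)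
      also have "norm2 (A (\<lambda>z. f z - u n z)) + norm2 (B (\<lambda>z. f z - u n z)) \<le> (C + D) * norm2 (\<lambda>z. f z - u n z)"
        using C[OF L2_diff[OF m(1,2)]] D[OF L2_diff[OF m(1,2)]] by (simp add: distrib_right)
      finally show ?thesis by simp
    qed
    then have "norm2 (\<lambda>z. A f z - B f z) \<le> 0"
      using tendsto_mult_right_zero[OF lim, of "C + D"] by (intro LIMSEQ_le_const) auto
    then have "norm2 (\<lambda>z. A f z - B f z) = 0" using norm2_nonneg by (rule antisym)
    with f show "f \<in> {f \<in> L2. eq2 (A f) (B f)}" using L2[OF f] by (simp add: eq2_iff_norm2)
  }
qed auto

locale cuntz_inner = inner_fun +
  fixes I :: "nat set" and v :: "nat \<Rightarrow> cfun"
  assumes nonconst: "nonconstant b" and onb: "orthonormal_basis I v (Dspace b)"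
begin

declare b_measurable [measurable] powi_b_measurable [measurable]

definition S :: "nat \<Rightarrow> cop" where
  "S i f = (\<lambda>z. v i z * f (b z))"

lemma v_Dspace: "i \<in> I \<Longrightarrow> v i \<in> Dspace b"
  using onb by (simp add: orthonormal_basis_def)

lemma v_H2: "i \<in> I \<Longrightarrow> v i \<in> H2"
  using v_Dspace by (simp add: Dspace_iff)

lemma v_L2: "i \<in> I \<Longrightarrow> v i \<in> L2"
  using v_H2 H2_L2 by blast

lemma Dspace_orth_powmult:
  assumes "d \<in> Dspace b" "h \<in> H2" "n > 0"
  shows "inner2 d (powmult b n h) = 0"
proof -
  have "inner2 d (powmult b n h) = inner2 d (powmult b 1 (powmult b (n - 1) h))"
    using assms powmult_powmult[of 1 "n - 1" h]
    by (intro inner2_cong) (auto simp: Dspace_iff H2_L2 eq2_sym)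
  also have "\<dots> = 0" using assms powmult_H2[of h "n - 1"] by (simp add: Dspace_iff)
  finally show ?thesis .
qed

text \<open>Positive powers of \<open>b\<close> take \<open>H2\<close> into the orthogonal
  complement of \<open>Dspace b\<close>; a negative power is moved to the other argument. The case
  \<open>i = j\<close> supplies the moments behind isometry, the case \<open>i \<noteq> j\<close>
  the orthogonality of the ranges.\<close>

lemma inner2_v:
  assumes "i \<in> I" "j \<in> I"
  shows "inner2 (powmult b n (v i)) (v j) = (if i = j \<and> n = 0 then 1 else 0)"
proof (cases n "0::int" rule: linorder_cases)
  case less
  then show ?thesis
    using Dspace_orth_powmult[OF v_Dspace v_H2, of i j "- n"] assms by (simp add: inner2_powmult v_L2)
next
  case equal
  then show ?thesis using onb assms by (simp add: orthonormal_basis_def)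
next
  case greater
  then show ?thesis
    using Dspace_orth_powmult[OF v_Dspace v_H2, of j i n] assms inner2_cnj[of "v j" "powmult b n (v i)"]
    by simp
qed

lemma S_e: "S i (e n) = powmult b n (v i)"
  by (simp add: S_def e_def powmult_def mult.commute fun_eq_iff)

text \<open>The moments of the push-forward of \<open>\<bar>v i\<bar>\<^sup>2 dm\<close> under \<open>b\<close> are the numbers \<open>inner2 (b\<^sup>n v i) (v i)\<close>.\<close>

lemma distr_v:
  assumes i: "i \<in> I"
  shows "distr (density circle (\<lambda>z. ennreal ((cmod (v i z))\<^sup>2))) borel b = circle"
proof (rule circle_measure_eqI)
  have [measurable]: "v i \<in> borel_measurable borel" using v_L2[OF i] by simp
  define M where "M = density circle (\<lambda>z. ennreal ((cmod (v i z))\<^sup>2))"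
  have sets: "sets M = sets borel" by (simp add: M_def)
  have bM [measurable]: "b \<in> measurable M borel"
    by (subst measurable_cong_sets[OF sets refl]) simp
  have "emeasure M UNIV = (\<integral>\<^sup>+z. ennreal ((cmod (v i z))\<^sup>2) \<partial>circle)"
    by (simp add: M_def emeasure_density)
  also have "\<dots> \<noteq> \<infinity>" by (simp add: L2_imp_nn_integral v_L2[OF i])
  finally show "finite_measure (distr (density circle (\<lambda>z. ennreal ((cmod (v i z))\<^sup>2))) borel b)"
    unfolding M_def[symmetric] by (intro finite_measureI) (simp add: emeasure_distr M_def)
  have "AE z in M. cmod (b z) = 1"
    unfolding M_def using AE_cmod_b by (subst AE_density) auto
  then show "AE z in distr (density circle (\<lambda>z. ennreal ((cmod (v i z))\<^sup>2))) borel b. cmod z = 1"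
    unfolding M_def[symmetric] by (subst AE_distr_iff) auto
  fix n :: int
  have "(\<integral>z. z powi n \<partial>distr M borel b) = (\<integral>z. b z powi n \<partial>M)"
    by (subst integral_distr) auto
  also have "\<dots> = (\<integral>z. (cmod (v i z))\<^sup>2 *\<^sub>R b z powi n \<partial>circle)"
    unfolding M_def by (subst integral_density) auto
  also have "\<dots> = inner2 (powmult b n (v i)) (v i)"
    unfolding inner2_def powmult_def
    by (intro Bochner_Integration.integral_cong refl)
      (simp only: scaleR_conv_of_real complex_norm_square mult_ac)
  also have "\<dots> = (\<integral>z. z powi n \<partial>circle)" using i by (simp add: inner2_v integral_circle_powi)
  finally show "(\<integral>z. z powi n \<partial>distr (density circle (\<lambda>z. ennreal ((cmod (v i z))\<^sup>2))) borel b) = (\<integral>z. z powi n \<partial>circle)"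
    by (simp add: M_def)
qed (use AE_circle_cmod in \<open>auto intro: circle.finite_measure_axioms\<close>)

text \<open>Change of variables: by \<open>distr_v\<close>, \<open>b\<close> carries the weighted
  measure \<open>|v i|^2 dm\<close> to \<open>circle\<close>.\<close>

lemma
  fixes h :: "complex \<Rightarrow> 'a :: {banach, second_countable_topology}"
  assumes i: "i \<in> I" and [measurable]: "h \<in> borel_measurable borel"
  shows integrable_compose_b: "integrable circle (\<lambda>z. (cmod (v i z))\<^sup>2 *\<^sub>R h (b z)) \<longleftrightarrow> integrable circle h"
    and integral_compose_b: "(\<integral>z. (cmod (v i z))\<^sup>2 *\<^sub>R h (b z) \<partial>circle) = (\<integral>z. h z \<partial>circle)"
proof -
  have [measurable]: "v i \<in> borel_measurable borel" using v_L2[OF i] by simp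
  define M where "M = density circle (\<lambda>z. ennreal ((cmod (v i z))\<^sup>2))"
  have sets: "sets M = sets borel" by (simp add: M_def)
  have bM [measurable]: "b \<in> measurable M borel"
    by (subst measurable_cong_sets[OF sets refl]) simp
  have hb [measurable]: "(\<lambda>z. h (b z)) \<in> borel_measurable borel" by measurable
  have "integrable circle h \<longleftrightarrow> integrable (distr M borel b) h"
    unfolding M_def distr_v[OF i] ..
  also have "\<dots> \<longleftrightarrow> integrable M (\<lambda>z. h (b z))" by (rule integrable_distr_eq) auto
  also have "\<dots> \<longleftrightarrow> integrable circle (\<lambda>z. (cmod (v i z))\<^sup>2 *\<^sub>R h (b z))"
    unfolding M_def by (rule integrable_density) auto
  finally show "integrable circle (\<lambda>z. (cmod (v i z))\<^sup>2 *\<^sub>R h (b z)) \<longleftrightarrow> integrable circle h" ..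
  have "(\<integral>z. h z \<partial>circle) = (\<integral>z. h z \<partial>distr M borel b)"
    unfolding M_def distr_v[OF i] ..
  also have "\<dots> = (\<integral>z. h (b z) \<partial>M)" by (rule integral_distr) auto
  also have "\<dots> = (\<integral>z. (cmod (v i z))\<^sup>2 *\<^sub>R h (b z) \<partial>circle)"
    unfolding M_def by (rule integral_density) auto
  finally show "(\<integral>z. (cmod (v i z))\<^sup>2 *\<^sub>R h (b z) \<partial>circle) = (\<integral>z. h z \<partial>circle)" ..
qed

lemma S_L2:
  assumes i: "i \<in> I" and f: "f \<in> L2" shows "S i f \<in> L2"
proof -
  have [measurable]: "v i \<in> borel_measurable borel" "f \<in> borel_measurable borel" using v_L2[OF i] f by simp_all
  have "integrable circle (\<lambda>z. (cmod (v i z))\<^sup>2 *\<^sub>R (cmod (f (b z)))\<^sup>2)"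
    using integrable_compose_b[OF i, of "\<lambda>z. (cmod (f z))\<^sup>2"] L2_integrable[OF f] by simp
  then show ?thesis
    unfolding S_def by (rule L2I[rotated]) (auto simp: norm_mult power_mult_distrib)
qed

lemma inner2_S_same:
  assumes i: "i \<in> I" and fg: "f \<in> L2" "g \<in> L2" shows "inner2 (S i f) (S i g) = inner2 f g"
proof -
  have "inner2 (S i f) (S i g) = (\<integral>z. (cmod (v i z))\<^sup>2 *\<^sub>R (f (b z) * cnj (g (b z))) \<partial>circle)"
    unfolding inner2_def S_def
    by (intro Bochner_Integration.integral_cong refl)
      (simp only: scaleR_conv_of_real complex_norm_square complex_cnj_mult mult_ac)
  also have "\<dots> = inner2 f g"
    unfolding inner2_def using integral_compose_b[OF i, of "\<lambda>z. f z * cnj (g z)"] fg by simp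
  finally show ?thesis .
qed

lemma norm2_S: "i \<in> I \<Longrightarrow> f \<in> L2 \<Longrightarrow> norm2 (S i f) = norm2 f"
  by (rule power2_eq_imp_eq) (auto simp: norm2_sq_Re inner2_S_same)

lemma S_linear: "S i (\<lambda>z. a * f z + c * g z) = (\<lambda>z. a * S i f z + c * S i g z)"
  by (simp add: S_def fun_eq_iff algebra_simps)

lemma S_diff: "S i (\<lambda>z. f z - g z) = (\<lambda>z. S i f z - S i g z)"
  by (simp add: S_def fun_eq_iff algebra_simps)

lemma norm2_S_diff:
  "i \<in> I \<Longrightarrow> f \<in> L2 \<Longrightarrow> g \<in> L2 \<Longrightarrow> norm2 (\<lambda>z. S i f z - S i g z) = norm2 (\<lambda>z. f z - g z)"
  using norm2_S[of i "\<lambda>z. f z - g z"] by (simp add: S_diff)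

text \<open>Since \<open>f - g\<close> has norm 0, so has its image under the isometry. Nothing
  about preimages of null sets under \<open>b\<close> enters, so \<open>AE_compose_b\<close> can
  rest on this without circularity.\<close>

lemma S_cong:
  assumes "i \<in> I" "f \<in> L2" "g \<in> L2" "eq2 f g" shows "eq2 (S i f) (S i g)"
  using assms by (simp add: eq2_iff_norm2 S_L2 norm2_S_diff)

text \<open>Isometries preserve norm convergence. With the density lemmas this reduces claims about
  \<open>S i f\<close> to the functions \<open>S i (e n)\<close>.\<close>

lemma closed_subspace_S_vimage:
  assumes i: "i \<in> I" and K: "closed_subspace K"
  shows "closed_subspace {f \<in> L2. S i f \<in> K}"
proof (rule closed_subspaceI)
  fix f u assume f: "f \<in> L2" and u: "\<And>n. u n \<in> {f \<in> L2. S i f \<in> K}"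
    and lim: "(\<lambda>n. norm2 (\<lambda>z. f z - u n z)) \<longlonglongrightarrow> 0"
  have "S i f \<in> K"
  proof (rule closed_subspaceD(4)[OF K S_L2[OF i f]])
    show "S i (u n) \<in> K" for n using u by simp
    have "norm2 (\<lambda>z. S i f z - S i (u n) z) = norm2 (\<lambda>z. f z - u n z)" for n
      by (rule norm2_S_diff) (use i f u in auto)
    then show "(\<lambda>n. norm2 (\<lambda>z. S i f z - S i (u n) z)) \<longlonglongrightarrow> 0" using lim by simp
  qed
  with f show "f \<in> {f \<in> L2. S i f \<in> K}" by simp
next
  show "(\<lambda>z. 0) \<in> {f \<in> L2. S i f \<in> K}" using closed_subspaceD(2)[OF K] by (simp add: S_def)
qed (auto simp: S_linear intro: closed_subspaceD(3)[OF K])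

lemma inner2_S:
  assumes ij: "i \<in> I" "j \<in> I" and fg: "f \<in> L2" "g \<in> L2"
  shows "inner2 (S i f) (S j g) = (if i = j then inner2 f g else 0)"
proof (cases "i = j")
  case False
  \<comment> \<open>Density is used in one argument at a time: here the second is frozen at
    \<open>e m\<close>, afterwards \<open>f\<close> is frozen and \<open>g\<close> varies.\<close>
  have 1: "inner2 (S i f) (S j (e m)) = 0" if "f \<in> L2" for f m
  proof -
    have "L2 \<subseteq> {f \<in> L2. S i f \<in> {h \<in> L2. \<forall>g\<in>{S j (e m)}. inner2 h g = 0}}"
    proof (rule L2_subset_closed_subspace)
      fix n
      have "inner2 (S i (e n)) (S j (e m)) = inner2 (powmult b (- m) (powmult b n (v i))) (v j)"
        using inner2_powmult[of "powmult b n (v i)" "v j" "- m"] ij by (simp add: S_e v_L2)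
      also have "\<dots> = inner2 (powmult b (- m + n) (v i)) (v j)"
        using powmult_powmult[of "- m" n "v i"] ij by (intro inner2_cong) (auto simp: v_L2)
      also have "\<dots> = 0" using ij False by (simp add: inner2_v)
      finally show "e n \<in> {f \<in> L2. S i f \<in> {h \<in> L2. \<forall>g\<in>{S j (e m)}. inner2 h g = 0}}"
        using ij by (simp add: S_L2)
    qed (intro closed_subspace_S_vimage[OF ij(1)] closed_subspace_orth, use ij in \<open>simp add: S_L2\<close>)
    with that show ?thesis by blast
  qed
  have "L2 \<subseteq> {g \<in> L2. S j g \<in> {h \<in> L2. \<forall>k\<in>{S i f}. inner2 h k = 0}}"
  proof (rule L2_subset_closed_subspace)
    fix n
    have "inner2 (S j (e n)) (S i f) = 0" using 1[OF fg(1), of n] inner2_cnj[of "S i f"] by (metis complex_cnj_zero)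
    then show "e n \<in> {g \<in> L2. S j g \<in> {h \<in> L2. \<forall>k\<in>{S i f}. inner2 h k = 0}}"
      using ij by (simp add: S_L2)
  qed (intro closed_subspace_S_vimage[OF ij(2)] closed_subspace_orth, use ij fg in \<open>simp add: S_L2\<close>)
  then have "inner2 (S j g) (S i f) = 0" using fg(2) by blast
  then show ?thesis using False inner2_cnj[of "S j g"] by (metis complex_cnj_zero)
qed (use assms in \<open>simp add: inner2_S_same\<close>)

lemma S_H2:
  assumes i: "i \<in> I" and f: "f \<in> H2" shows "S i f \<in> H2"
proof -
  have "H2 \<subseteq> {f \<in> L2. S i f \<in> H2}"
    by (rule H2_subset_closed_subspace[OF closed_subspace_S_vimage[OF i closed_subspace_H2]])
      (simp add: S_e powmult_H2 v_H2[OF i])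
  with f show ?thesis by blast
qed

text \<open>Preimages of a Cauchy sequence under an isometry are again Cauchy, so completeness
  provides a preimage of the limit. Closedness of the range is what lets the adjoint be built by
  projection.\<close>

lemma closed_subspace_range_S:
  assumes i: "i \<in> I"
  shows "closed_subspace {h \<in> L2. \<exists>g\<in>L2. eq2 h (S i g)}"
proof (rule closed_subspaceI)
  show "(\<lambda>z. 0) \<in> {h \<in> L2. \<exists>g\<in>L2. eq2 h (S i g)}"
    by (auto simp: S_def intro!: bexI[of _ "\<lambda>z. 0"])
next
  fix h k a c
  assume "h \<in> {h \<in> L2. \<exists>g\<in>L2. eq2 h (S i g)}" "k \<in> {h \<in> L2. \<exists>g\<in>L2. eq2 h (S i g)}"
  then obtain f g where fg: "h \<in> L2" "k \<in> L2" "f \<in> L2" "g \<in> L2" "eq2 h (S i f)" "eq2 k (S i g)" by blast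
  then have "eq2 (\<lambda>z. a * h z + c * k z) (S i (\<lambda>z. a * f z + c * g z))"
    unfolding S_linear eq2_def by auto
  moreover have "(\<lambda>z. a * f z + c * g z) \<in> L2" "(\<lambda>z. a * h z + c * k z) \<in> L2" using fg by auto
  ultimately show "(\<lambda>z. a * h z + c * k z) \<in> {h \<in> L2. \<exists>g\<in>L2. eq2 h (S i g)}" by blast
next
  fix h u assume h: "h \<in> L2" and u: "\<And>n. u n \<in> {h \<in> L2. \<exists>g\<in>L2. eq2 h (S i g)}"
    and lim: "(\<lambda>n. norm2 (\<lambda>z. h z - u n z)) \<longlonglongrightarrow> 0"
  from u have uL2: "u n \<in> L2" for n by blast
  from u have "\<exists>g. g \<in> L2 \<and> eq2 (u n) (S i g)" for n by blast
  then obtain g where g: "\<And>n. g n \<in> L2" "\<And>n. eq2 (u n) (S i (g n))" by metis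
  have eq: "norm2 (\<lambda>z. k z - u n z) = norm2 (\<lambda>z. k z - S i (g n) z)" if "k \<in> L2" for k n
  proof (rule norm2_cong)
    show "eq2 (\<lambda>z. k z - u n z) (\<lambda>z. k z - S i (g n) z)"
      using g(2)[of n] unfolding eq2_def by (rule eventually_mono) simp
  qed (use that uL2 S_L2[OF i g(1)] in auto)
  have eq': "norm2 (\<lambda>z. g m z - g n z) = norm2 (\<lambda>z. u m z - u n z)" for m n
  proof -
    have "norm2 (\<lambda>z. u m z - u n z) = norm2 (\<lambda>z. u m z - S i (g n) z)" by (rule eq[OF uL2])
    also have "\<dots> = norm2 (\<lambda>z. S i (g n) z - u m z)" by (rule norm2_minus_commute)
    also have "\<dots> = norm2 (\<lambda>z. S i (g n) z - S i (g m) z)" by (rule eq[OF S_L2[OF i g(1)]])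
    also have "\<dots> = norm2 (\<lambda>z. g n z - g m z)" by (rule norm2_S_diff[OF i g(1) g(1)])
    finally show ?thesis by (simp add: norm2_minus_commute[of "g m"])
  qed
  have "\<exists>M. \<forall>m\<ge>M. \<forall>n\<ge>M. norm2 (\<lambda>z. g m z - g n z) < \<epsilon>" if "\<epsilon> > 0" for \<epsilon>
  proof -
    have "\<forall>\<^sub>F n in sequentially. norm2 (\<lambda>z. h z - u n z) < \<epsilon>/2"
      using order_tendstoD(2)[OF lim, of "\<epsilon>/2"] that by simp
    then obtain M where M: "\<And>n. n \<ge> M \<Longrightarrow> norm2 (\<lambda>z. h z - u n z) < \<epsilon>/2"
      unfolding eventually_sequentially by auto
    have "norm2 (\<lambda>z. g m z - g n z) < \<epsilon>" if "m \<ge> M" "n \<ge> M" for m n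
    proof -
      have "norm2 (\<lambda>z. u m z - u n z) \<le> norm2 (\<lambda>z. u m z - h z) + norm2 (\<lambda>z. h z - u n z)"
        by (rule norm2_triangle_diff) (auto intro: uL2 h)
      then show ?thesis
        using M[OF that(1)] M[OF that(2)] norm2_minus_commute[of "u m" h] eq'[of m n] by linarith
    qed
    then show ?thesis by blast
  qed
  then obtain g' where g': "g' \<in> L2" "(\<lambda>n. norm2 (\<lambda>z. g' z - g n z)) \<longlonglongrightarrow> 0"
    using L2_complete[of g] g(1) by blast
  have "norm2 (\<lambda>z. h z - S i g' z) \<le> norm2 (\<lambda>z. h z - u n z) + norm2 (\<lambda>z. g' z - g n z)" for n
  proof -
    have "norm2 (\<lambda>z. h z - S i g' z) \<le> norm2 (\<lambda>z. h z - u n z) + norm2 (\<lambda>z. u n z - S i g' z)"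
      by (rule norm2_triangle_diff) (auto intro: uL2 h S_L2 i g')
    also have "norm2 (\<lambda>z. u n z - S i g' z) = norm2 (\<lambda>z. S i g' z - u n z)"
      by (rule norm2_minus_commute)
    also have "\<dots> = norm2 (\<lambda>z. S i g' z - S i (g n) z)" by (rule eq[OF S_L2[OF i g'(1)]])
    also have "\<dots> = norm2 (\<lambda>z. g' z - g n z)" by (rule norm2_S_diff[OF i g'(1) g(1)])
    finally show ?thesis .
  qed
  then have "norm2 (\<lambda>z. h z - S i g' z) \<le> 0"
    using tendsto_add_zero[OF lim g'(2)] by (intro LIMSEQ_le_const) auto
  then have "norm2 (\<lambda>z. h z - S i g' z) = 0" using norm2_nonneg by (rule antisym)
  then have "eq2 h (S i g')" using h g'(1) i by (simp add: eq2_iff_norm2 S_L2)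
  with h g'(1) show "h \<in> {h \<in> L2. \<exists>g\<in>L2. eq2 h (S i g)}" by blast
qed auto

section \<open>The adjoints of the isometries\<close>

definition Sa :: "nat \<Rightarrow> cop" where
  "Sa i f = (SOME g. g \<in> L2 \<and> (\<forall>h\<in>L2. inner2 f (S i h) = inner2 g h))"

text \<open>Project \<open>f\<close> onto the range of \<open>S i\<close> and write the projection
  as \<open>S i g\<close>: since \<open>S i\<close> preserves inner products, \<open>g\<close> has
  exactly those required of the adjoint.\<close>

lemma
  assumes i: "i \<in> I" and f: "f \<in> L2"
  shows Sa_L2: "Sa i f \<in> L2" and inner2_Sa: "h \<in> L2 \<Longrightarrow> inner2 (Sa i f) h = inner2 f (S i h)"
proof -
  obtain q where q: "q \<in> {h \<in> L2. \<exists>g\<in>L2. eq2 h (S i g)}"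
      and orth: "\<And>h. h \<in> {h \<in> L2. \<exists>g\<in>L2. eq2 h (S i g)} \<Longrightarrow> inner2 (\<lambda>z. f z - q z) h = 0"
    using L2_projection[OF closed_subspace_range_S[OF i] f] by blast
  then obtain g where g: "q \<in> L2" "g \<in> L2" "eq2 q (S i g)" by blast
  have "inner2 f (S i h) = inner2 g h" if "h \<in> L2" for h
  proof -
    have "S i h \<in> {h \<in> L2. \<exists>g\<in>L2. eq2 h (S i g)}" using that i S_L2 eq2_refl by blast
    then have "inner2 f (S i h) = inner2 q (S i h)"
      using orth f g(1) that i by (simp add: inner2_diff_left S_L2)
    also have "\<dots> = inner2 (S i g) (S i h)"
      using S_L2[OF i] that g by (intro inner2_cong) auto
    also have "\<dots> = inner2 g h" using i g(2) that by (simp add: inner2_S_same)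
    finally show ?thesis .
  qed
  with g(2) have "\<exists>g. g \<in> L2 \<and> (\<forall>h\<in>L2. inner2 f (S i h) = inner2 g h)" by blast
  from someI_ex[OF this]
  show "Sa i f \<in> L2" and "h \<in> L2 \<Longrightarrow> inner2 (Sa i f) h = inner2 f (S i h)"
    unfolding Sa_def by auto
qed

lemma inner2_S_adjoint: "\<lbrakk>i \<in> I; f \<in> L2; g \<in> L2\<rbrakk> \<Longrightarrow> inner2 (S i f) g = inner2 f (Sa i g)"
  using inner2_Sa[of i g f] inner2_cnj by metis

text \<open>For \<open>n < 0\<close> the coefficient is the conjugate of the inner product of
  \<open>v i\<close> with \<open>powmult b (- n) f\<close>, and \<open>v i\<close> is orthogonal to
  positive powers of \<open>b\<close> times \<open>H2\<close>. The other half of reduction is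
  \<open>S_H2\<close>.\<close>

lemma Sa_H2:
  assumes i: "i \<in> I" and f: "f \<in> H2" shows "Sa i f \<in> H2"
proof -
  have "fourier (Sa i f) n = 0" if "n < 0" for n
  proof -
    have "fourier (Sa i f) n = inner2 f (powmult b n (v i))"
      using i f by (simp add: fourier_def inner2_Sa H2_L2 S_e)
    also have "\<dots> = cnj (inner2 (v i) (powmult b (- n) f))"
      using i f inner2_powmult[of "v i" f n] inner2_cnj[of "powmult b n (v i)" f]
      by (simp add: v_L2 H2_L2)
    also have "\<dots> = 0" using Dspace_orth_powmult[OF v_Dspace[OF i] f, of "- n"] that by simp
    finally show ?thesis .
  qed
  then show ?thesis using Sa_L2[OF i] f by (simp add: H2_def)
qed

lemma norm2_Sa_le:
  assumes i: "i \<in> I" and f: "f \<in> L2" shows "norm2 (Sa i f) \<le> norm2 f"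
proof -
  have "(norm2 (Sa i f))\<^sup>2 = cmod (inner2 (Sa i f) (Sa i f))"
    by (simp only: inner2_self norm_of_real) simp
  also have "\<dots> = cmod (inner2 f (S i (Sa i f)))"
    using inner2_Sa[OF i f Sa_L2[OF i f]] by simp
  also have "\<dots> \<le> norm2 f * norm2 (S i (Sa i f))"
    by (intro inner2_CS f S_L2 i Sa_L2)
  also have "norm2 (S i (Sa i f)) = norm2 (Sa i f)" by (rule norm2_S[OF i Sa_L2[OF i f]])
  finally have "norm2 (Sa i f) * norm2 (Sa i f) \<le> norm2 f * norm2 (Sa i f)"
    by (simp add: power2_eq_square)
  then show ?thesis
    by (cases "norm2 (Sa i f) = 0") (auto simp: mult_le_cancel_right order.strict_iff_order)
qed

lemma Sa_cong:
  assumes i: "i \<in> I" and "f \<in> L2" "g \<in> L2" "eq2 f g" shows "eq2 (Sa i f) (Sa i g)"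
proof (rule eq2_testI[OF closed_subspace_L2])
  fix h assume h: "h \<in> L2"
  have "inner2 f (S i h) = inner2 g (S i h)"
    using assms S_L2[OF i h] by (intro inner2_cong) auto
  then show "inner2 (Sa i f) h = inner2 (Sa i g) h" using assms h by (simp add: inner2_Sa)
qed (use assms Sa_L2 in auto)

lemma Sa_linear:
  assumes i: "i \<in> I" and fg: "f \<in> L2" "g \<in> L2"
  shows "eq2 (Sa i (\<lambda>z. a * f z + c * g z)) (\<lambda>z. a * Sa i f z + c * Sa i g z)"
proof (rule eq2_testI[OF closed_subspace_L2])
  fix h assume h: "h \<in> L2"
  have "inner2 (\<lambda>z. a * f z + c * g z) (S i h) = a * inner2 f (S i h) + c * inner2 g (S i h)"
    using fg S_L2[OF i h] by (simp add: inner2_add_left inner2_scale_left)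
  moreover have "inner2 (\<lambda>z. a * Sa i f z + c * Sa i g z) h = a * inner2 (Sa i f) h + c * inner2 (Sa i g) h"
    using Sa_L2[OF i] fg h by (simp add: inner2_add_left inner2_scale_left)
  ultimately show "inner2 (Sa i (\<lambda>z. a * f z + c * g z)) h = inner2 (\<lambda>z. a * Sa i f z + c * Sa i g z) h"
    using i fg h by (simp add: inner2_Sa)
qed (use i fg Sa_L2 in auto)

lemma Sa_S:
  assumes ij: "i \<in> I" "j \<in> I" and f: "f \<in> L2"
  shows "eq2 (Sa i (S j f)) (if i = j then f else (\<lambda>z. 0))"
proof (rule eq2_testI[OF closed_subspace_L2])
  fix h assume h: "h \<in> L2"
  have "inner2 (Sa i (S j f)) h = inner2 (S j f) (S i h)"
    by (rule inner2_Sa[OF ij(1) S_L2[OF ij(2) f] h])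
  then show "inner2 (Sa i (S j f)) h = inner2 (if i = j then f else (\<lambda>z. 0)) h"
    using ij f h by (auto simp: inner2_S)
qed (use ij f Sa_L2 S_L2 in auto)

lemma bounded_op_S: "i \<in> I \<Longrightarrow> bounded_op L2 (S i)"
  unfolding bounded_op_def
  by (auto simp: S_L2 S_cong S_linear norm2_S intro!: exI[of _ 1])

lemma bounded_op_Sa: "i \<in> I \<Longrightarrow> bounded_op L2 (Sa i)"
  unfolding bounded_op_def
  by (auto simp: Sa_L2 Sa_cong Sa_linear norm2_Sa_le intro!: exI[of _ 1])

lemma bounded_op_H2: "bounded_op L2 A \<Longrightarrow> (\<And>f. f \<in> H2 \<Longrightarrow> A f \<in> H2) \<Longrightarrow> bounded_op H2 A"
  unfolding bounded_op_def using H2_L2 by blast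

lemma is_adjoint_Sa: "i \<in> I \<Longrightarrow> is_adjoint L2 (S i) (Sa i)"
  unfolding is_adjoint_def by (auto simp: bounded_op_Sa inner2_S_adjoint)

lemma is_adjoint_Sa_H2: "i \<in> I \<Longrightarrow> is_adjoint H2 (S i) (Sa i)"
  unfolding is_adjoint_def by (auto simp: bounded_op_H2 bounded_op_Sa Sa_H2 inner2_S_adjoint H2_L2)

text \<open>Moving powers of \<open>b\<close> across, the hypothesis says that every
  \<open>powmult b n f\<close> is orthogonal to the basis \<open>v\<close>, hence to
  \<open>Dspace b\<close>; this is the situation of \<open>wandering_eq_0\<close>.\<close>

lemma total_S:
  assumes f: "f \<in> L2" and orth: "\<And>i n. i \<in> I \<Longrightarrow> inner2 f (S i (e n)) = 0"
  shows "eq2 f (\<lambda>z. 0)"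
proof (rule wandering_eq_0[OF nonconst f])
  fix n d assume d: "d \<in> Dspace b"
  have "Dspace b \<subseteq> {d \<in> L2. \<forall>g\<in>{powmult b n f}. inner2 d g = 0}"
  proof (rule orthonormal_basis_subset[OF onb])
    fix i assume i: "i \<in> I"
    have "inner2 (powmult b n f) (v i) = 0"
      using orth[OF i, of "- n"] f i by (simp add: inner2_powmult v_L2 S_e)
    then have "inner2 (v i) (powmult b n f) = 0" using inner2_cnj by (metis complex_cnj_zero)
    then show "v i \<in> {d \<in> L2. \<forall>g\<in>{powmult b n f}. inner2 d g = 0}" using i by (simp add: v_L2)
  next
    show "closed_subspace {d \<in> L2. \<forall>g\<in>{powmult b n f}. inner2 d g = 0}"
      by (rule closed_subspace_orth) (use f in simp)
  qed (auto simp: Dspace_iff H2_L2)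
  then have "inner2 d (powmult b n f) = 0" using d by blast
  then show "inner2 (powmult b n f) d = 0" using inner2_cnj by (metis complex_cnj_zero)
qed

end

section \<open>Strong convergence of the sum of the range projections\<close>

context cuntz_inner
begin

definition T :: "nat \<Rightarrow> cop" where
  "T n f = (\<lambda>z. \<Sum>i\<in>I \<inter> {..<n}. S i (Sa i f) z)"

lemma T_L2: "f \<in> L2 \<Longrightarrow> T n f \<in> L2"
  unfolding T_def by (rule L2_sum) (simp add: S_L2 Sa_L2)

lemma inner2_T:
  assumes "f \<in> L2" "h \<in> L2"
  shows "inner2 (T n f) h = (\<Sum>i\<in>I \<inter> {..<n}. inner2 (Sa i f) (Sa i h))"
  unfolding T_def using assms by (subst inner2_sum_left) (auto simp: S_L2 Sa_L2 inner2_S_adjoint)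

lemma T_linear:
  assumes "f \<in> L2" "g \<in> L2"
  shows "eq2 (T n (\<lambda>z. a * f z + c * g z)) (\<lambda>z. a * T n f z + c * T n g z)"
proof (rule eq2_testI[OF closed_subspace_L2])
  fix h assume h: "h \<in> L2"
  have "inner2 (Sa i (\<lambda>z. a * f z + c * g z)) (Sa i h) = a * inner2 (Sa i f) (Sa i h) + c * inner2 (Sa i g) (Sa i h)"
    if i: "i \<in> I" for i
  proof -
    have "inner2 (Sa i (\<lambda>z. a * f z + c * g z)) (Sa i h) = inner2 (\<lambda>z. a * Sa i f z + c * Sa i g z) (Sa i h)"
      using Sa_linear[OF i assms, of a c] Sa_L2[OF i] assms h by (intro inner2_cong) auto
    then show ?thesis using Sa_L2[OF i] assms h by (simp add: inner2_add_left inner2_scale_left)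
  qed
  then have "inner2 (T n (\<lambda>z. a * f z + c * g z)) h = a * inner2 (T n f) h + c * inner2 (T n g) h"
    using assms h by (simp add: inner2_T sum.distrib sum_distrib_left)
  then show "inner2 (T n (\<lambda>z. a * f z + c * g z)) h = inner2 (\<lambda>z. a * T n f z + c * T n g z) h"
    using assms h by (simp add: inner2_add_left inner2_scale_left T_L2)
qed (use assms T_L2 in auto)

lemma T_S:
  assumes j: "j \<in> I" and f: "f \<in> L2"
  shows "eq2 (T n (S j f)) (if j < n then S j f else (\<lambda>z. 0))"
proof (rule eq2_testI[OF closed_subspace_L2])
  fix h assume h: "h \<in> L2"
  have "inner2 (Sa i (S j f)) (Sa i h) = (if i = j then inner2 f (Sa j h) else 0)" if i: "i \<in> I" for i
  proof -
    have "inner2 (Sa i (S j f)) (Sa i h) = inner2 (if i = j then f else (\<lambda>z. 0)) (Sa i h)"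
      using Sa_S[OF i j f] Sa_L2[OF i] S_L2[OF j f] h f by (intro inner2_cong) auto
    then show ?thesis by simp
  qed
  then have "inner2 (T n (S j f)) h = (if j < n then inner2 f (Sa j h) else 0)"
    using j f h by (simp add: inner2_T S_L2 sum.delta)
  then show "inner2 (T n (S j f)) h = inner2 (if j < n then S j f else (\<lambda>z. 0)) h"
    using j f h by (simp add: inner2_S_adjoint)
qed (use assms T_L2 S_L2 in auto)

text \<open>\<open>T n\<close> is an orthogonal projection: orthogonal ranges give idempotence, the
  formula \<open>inner2_T\<close> gives symmetry, and Pythagoras gives the bound. Its uniformity in
  \<open>n\<close> is what the density argument in \<open>T_tendsto\<close> needs.\<close>

lemma norm2_diff_T_le:
  assumes f: "f \<in> L2"
  shows "norm2 (\<lambda>z. f z - T n f z) \<le> norm2 f"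
proof (rule power2_le_imp_le)
  have "inner2 (Sa i (T n f)) (Sa i f) = inner2 (Sa i f) (Sa i f)" if i: "i \<in> I \<inter> {..<n}" for i
  proof -
    have i': "i \<in> I" using i by simp
    have "inner2 (Sa i (T n f)) (Sa i f) = inner2 (T n f) (S i (Sa i f))"
      using i' f by (intro inner2_Sa T_L2 Sa_L2)
    also have "\<dots> = (\<Sum>j\<in>I \<inter> {..<n}. inner2 (Sa j f) (Sa j (S i (Sa i f))))"
      using i' f by (intro inner2_T S_L2 Sa_L2)
    also have "\<dots> = (\<Sum>j\<in>I \<inter> {..<n}. inner2 (Sa j f) (if j = i then Sa i f else (\<lambda>z. 0)))"
      using f Sa_S[OF _ i' Sa_L2[OF i' f]] Sa_L2 S_L2 i'
      by (intro sum.cong inner2_cong refl) auto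
    also have "\<dots> = (\<Sum>j\<in>I \<inter> {..<n}. if j = i then inner2 (Sa i f) (Sa i f) else 0)"
      by (intro sum.cong) auto
    also have "\<dots> = inner2 (Sa i f) (Sa i f)" using i by simp
    finally show ?thesis .
  qed
  then have "inner2 (T n (T n f)) f = inner2 (T n f) f"
    using f by (simp add: inner2_T T_L2)
  moreover have "inner2 (T n (T n f)) f = inner2 (T n f) (T n f)"
  proof -
    have "inner2 (T n f) (T n f) = cnj (inner2 (T n f) (T n f))" by (rule inner2_cnj[symmetric])
    also have "\<dots> = (\<Sum>i\<in>I \<inter> {..<n}. cnj (inner2 (Sa i f) (Sa i (T n f))))"
      using f by (simp add: inner2_T T_L2)
    also have "\<dots> = inner2 (T n (T n f)) f"
      using f by (simp add: inner2_T T_L2 inner2_cnj)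
    finally show ?thesis ..
  qed
  ultimately have T: "inner2 (T n f) f = inner2 (T n f) (T n f)" by simp
  have "Re (inner2 f (T n f)) = Re (inner2 (T n f) f)" by (simp flip: inner2_cnj[of f "T n f"])
  also have "\<dots> = (norm2 (T n f))\<^sup>2" unfolding T by (simp add: norm2_sq_Re)
  finally have "(norm2 (\<lambda>z. f z - T n f z))\<^sup>2 = (norm2 f)\<^sup>2 - (norm2 (T n f))\<^sup>2"
    using f by (simp add: norm2_diff_sq T_L2)
  then show "(norm2 (\<lambda>z. f z - T n f z))\<^sup>2 \<le> (norm2 f)\<^sup>2" by simp
qed simp

text \<open>The vectors for which convergence holds form a closed subspace by the uniform bound. It
  contains every \<open>S j (e m)\<close>, on which \<open>T n\<close> is the identity for
  \<open>n > j\<close>, and by \<open>total_S\<close> only null functions are orthogonal to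
  these.\<close>

theorem T_tendsto:
  assumes "f \<in> L2"
  shows "(\<lambda>n. norm2 (\<lambda>z. f z - T n f z)) \<longlonglongrightarrow> 0"
proof -
  define K where "K = {f \<in> L2. (\<lambda>n. norm2 (\<lambda>z. f z - T n f z)) \<longlonglongrightarrow> 0}"
  have lin: "norm2 (\<lambda>z. (a * f z + c * g z) - T n (\<lambda>z. a * f z + c * g z) z)
      \<le> cmod a * norm2 (\<lambda>z. f z - T n f z) + cmod c * norm2 (\<lambda>z. g z - T n g z)"
    if fg: "f \<in> L2" "g \<in> L2" for f g a c n
  proof -
    have "norm2 (\<lambda>z. (a * f z + c * g z) - T n (\<lambda>z. a * f z + c * g z) z)
        = norm2 (\<lambda>z. a * (f z - T n f z) + c * (g z - T n g z))"
    proof (rule norm2_cong)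
      show "eq2 (\<lambda>z. (a * f z + c * g z) - T n (\<lambda>z. a * f z + c * g z) z)
          (\<lambda>z. a * (f z - T n f z) + c * (g z - T n g z))"
        using T_linear[OF fg, of n a c] unfolding eq2_def
        by (rule eventually_mono) (simp add: algebra_simps)
    qed (use fg T_L2 in auto)
    also have "\<dots> \<le> norm2 (\<lambda>z. a * (f z - T n f z)) + norm2 (\<lambda>z. c * (g z - T n g z))"
      by (rule norm2_triangle) (use fg T_L2 in auto)
    finally show ?thesis by (simp only: norm2_scale)
  qed
  have K: "closed_subspace K"
  proof (rule closed_subspaceI)
    have "norm2 (\<lambda>z. 0 - T n (\<lambda>z. 0) z) \<le> 0" for n
      using norm2_diff_T_le[of "\<lambda>z. 0" n] by simp
    then have "norm2 (\<lambda>z. 0 - T n (\<lambda>z. 0) z) = 0" for n using norm2_nonneg by (rule antisym)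
    then show "(\<lambda>z. 0) \<in> K" by (simp add: K_def)
  next
    fix f g a c assume "f \<in> K" "g \<in> K"
    then have fg: "f \<in> L2" "g \<in> L2" and lim: "(\<lambda>n. norm2 (\<lambda>z. f z - T n f z)) \<longlonglongrightarrow> 0"
        "(\<lambda>n. norm2 (\<lambda>z. g z - T n g z)) \<longlonglongrightarrow> 0"
      by (auto simp: K_def)
    have "(\<lambda>n. norm2 (\<lambda>z. (a * f z + c * g z) - T n (\<lambda>z. a * f z + c * g z) z)) \<longlonglongrightarrow> 0"
    proof (rule tendsto_sandwich[OF _ _ tendsto_const])
      show "(\<lambda>n. cmod a * norm2 (\<lambda>z. f z - T n f z) + cmod c * norm2 (\<lambda>z. g z - T n g z)) \<longlonglongrightarrow> 0"
        by (intro tendsto_add_zero tendsto_mult_right_zero lim)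
    qed (auto intro!: always_eventually lin[OF fg])
    then show "(\<lambda>z. a * f z + c * g z) \<in> K" using fg by (simp add: K_def)
  next
    fix f u assume f: "f \<in> L2" and u: "\<And>k. u k \<in> K" and lim: "(\<lambda>k. norm2 (\<lambda>z. f z - u k z)) \<longlonglongrightarrow> 0"
    have uL2: "u k \<in> L2" for k using u[of k] by (simp add: K_def)
    have "(\<lambda>n. norm2 (\<lambda>z. f z - T n f z)) \<longlonglongrightarrow> 0"
    proof (rule LIMSEQ_I)
      fix \<epsilon> :: real assume \<epsilon>: "\<epsilon> > 0"
      have "\<forall>\<^sub>F k in sequentially. norm2 (\<lambda>z. f z - u k z) < \<epsilon>/2"
        using order_tendstoD(2)[OF lim, of "\<epsilon>/2"] \<epsilon> by simp
      then obtain k where k: "norm2 (\<lambda>z. f z - u k z) < \<epsilon>/2"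
        unfolding eventually_sequentially by auto
      have "(\<lambda>n. norm2 (\<lambda>z. u k z - T n (u k) z)) \<longlonglongrightarrow> 0" using u[of k] by (simp add: K_def)
      then have "\<forall>\<^sub>F n in sequentially. norm2 (\<lambda>z. u k z - T n (u k) z) < \<epsilon>/2"
        using order_tendstoD(2)[of _ 0 sequentially "\<epsilon>/2"] \<epsilon> by simp
      then obtain M where M: "\<And>n. n \<ge> M \<Longrightarrow> norm2 (\<lambda>z. u k z - T n (u k) z) < \<epsilon>/2"
        unfolding eventually_sequentially by auto
      have "norm2 (\<lambda>z. f z - T n f z) < \<epsilon>" if "n \<ge> M" for n
      proof -
        define g where "g z = f z - u k z" for z
        have g: "g \<in> L2" unfolding g_def using f uL2 by simp
        have "f = (\<lambda>z. 1 * g z + 1 * u k z)" by (simp add: g_def fun_eq_iff)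
        then have "norm2 (\<lambda>z. f z - T n f z) \<le> norm2 (\<lambda>z. g z - T n g z) + norm2 (\<lambda>z. u k z - T n (u k) z)"
          using lin[OF g uL2, of 1 1 k n] by simp
        also have "norm2 (\<lambda>z. g z - T n g z) \<le> norm2 g" by (rule norm2_diff_T_le[OF g])
        finally show ?thesis using k M[OF that] by (simp add: g_def[abs_def])
      qed
      then show "\<exists>no. \<forall>n\<ge>no. norm (norm2 (\<lambda>z. f z - T n f z) - 0) < \<epsilon>" by auto
    qed
    with f show "f \<in> K" by (simp add: K_def)
  qed (auto simp: K_def)
  have SK: "S j (e m) \<in> K" if j: "j \<in> I" for j m
  proof -
    have "norm2 (\<lambda>z. S j (e m) z - T n (S j (e m)) z) = 0" if "n > j" for n
    proof -
      have "eq2 (S j (e m)) (T n (S j (e m)))"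
        using T_S[OF j e_in_L2, of n m] that by (simp add: eq2_sym)
      then show ?thesis
        using eq2_iff_norm2[OF S_L2[OF j e_in_L2] T_L2[OF S_L2[OF j e_in_L2]]] by blast
    qed
    then have "(\<lambda>n. norm2 (\<lambda>z. S j (e m) z - T n (S j (e m)) z)) \<longlonglongrightarrow> 0"
      by (intro tendsto_eventually) (auto simp: eventually_sequentially intro!: exI[of _ "Suc j"])
    then show ?thesis using S_L2[OF j e_in_L2] by (simp add: K_def)
  qed
  have "K = L2"
  proof (rule closed_subspace_eqI[OF K closed_subspace_L2])
    fix f assume f: "f \<in> L2" and orth: "\<And>g. g \<in> K \<Longrightarrow> inner2 f g = 0"
    show "eq2 f (\<lambda>z. 0)" by (rule total_S[OF f orth[OF SK]])
  qed (use closed_subspaceD(1)[OF K] in blast)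
  with assms show ?thesis unfolding K_def by blast
qed

section \<open>Cuntz relations, reduction, uniqueness and covariance\<close>

lemma cuntz_family_L2: "cuntz_family L2 I S"
  unfolding cuntz_family_def
proof (intro conjI exI[of _ Sa] ballI)
  fix f assume "f \<in> L2"
  then show "(\<lambda>n. norm2 (\<lambda>z. f z - (\<Sum>i\<in>I \<inter> {..<n}. S i (Sa i f) z))) \<longlonglongrightarrow> 0"
    by (rule T_tendsto[unfolded T_def])
qed (auto simp: bounded_op_S is_adjoint_Sa op_eq_def dest: Sa_S)

lemma cuntz_family_H2: "cuntz_family H2 I S"
  unfolding cuntz_family_def
proof (intro conjI exI[of _ Sa] ballI)
  fix f assume "f \<in> H2"
  then show "(\<lambda>n. norm2 (\<lambda>z. f z - (\<Sum>i\<in>I \<inter> {..<n}. S i (Sa i f) z))) \<longlonglongrightarrow> 0"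
    by (rule T_tendsto[OF H2_L2, unfolded T_def])
next
  fix i j assume ij: "i \<in> I" "j \<in> I"
  show "op_eq H2 (Sa i \<circ> S j) (if i = j then id else (\<lambda>f z. 0))"
    using Sa_S[OF ij H2_L2] by (auto simp: op_eq_def)
qed (auto simp: bounded_op_H2 bounded_op_S S_H2 is_adjoint_Sa_H2)

lemma reduces_S:
  assumes i: "i \<in> I" shows "reduces H2 (S i)"
proof -
  have "A' f \<in> H2" if A': "is_adjoint L2 (S i) A'" and f: "f \<in> H2" for A' f
  proof -
    have eq: "eq2 (A' f) (Sa i f)"
      using adjoint_unique[OF closed_subspace_L2 S_L2[OF i] A' is_adjoint_Sa[OF i] H2_L2[OF f]] .
    have "A' f \<in> L2"
      using A' H2_L2[OF f] unfolding is_adjoint_def bounded_op_def by blast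
    then show ?thesis
      by (rule closed_subspace_eq2[OF closed_subspace_H2 Sa_H2[OF i f] _ eq])
  qed
  then show ?thesis unfolding reduces_def using S_H2[OF i] by blast
qed

lemma S_unique:
  assumes i: "i \<in> I" and A: "bounded_op L2 A" and e: "\<And>n. eq2 (A (e n)) (S i (e n))"
  shows "op_eq L2 A (S i)"
  using L2_subset_closed_subspace[OF bounded_op_agree[OF A bounded_op_S[OF i]]] e
  by (auto simp: op_eq_def)

text \<open>Null sets pull back to null sets under \<open>b\<close>: the indicator of the preimage is orthogonal
  to all \<open>S i (e n)\<close>.\<close>

lemma AE_compose_b:
  assumes [measurable]: "\<phi> \<in> borel_measurable borel" and AE: "AE z in circle. cmod (\<phi> z) \<le> C"
  shows "AE z in circle. cmod (\<phi> (b z)) \<le> C"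
proof -
  define g where "g z = (if cmod (\<phi> z) \<le> C then 0 else 1 :: complex)" for z
  have [measurable]: "g \<in> borel_measurable borel" unfolding g_def by measurable
  have gb [measurable]: "(\<lambda>z. g (b z)) \<in> borel_measurable borel" by measurable
  have L2: "(\<lambda>z. g (b z)) \<in> L2"
    by (rule L2_bounded[where C=1]) (auto simp: g_def)
  have "eq2 (\<lambda>z. g (b z)) (\<lambda>z. 0)"
  proof (rule total_S[OF L2])
    fix i n assume i: "i \<in> I"
    have ge: "(\<lambda>z. g z * e n z) \<in> L2"
      by (rule L2_mult_bounded[where C=1]) (auto simp: g_def)
    have "eq2 (\<lambda>z. g z * e n z) (\<lambda>z. 0)"
      unfolding eq2_def using AE by eventually_elim (simp add: g_def)
    then have 0: "eq2 (S i (\<lambda>z. g z * e n z)) (S i (\<lambda>z. 0))"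
      by (intro S_cong i ge) auto
    \<comment> \<open>\<open>g\<close> takes only the values 0 and 1, so it equals its conjugate and
      can be moved into the second argument, where \<open>S i\<close> acts on a null
      function.\<close>
    have "inner2 (\<lambda>z. g (b z)) (S i (e n)) = inner2 (\<lambda>z. 1) (S i (\<lambda>z. g z * e n z))"
      unfolding inner2_def S_def
      by (intro Bochner_Integration.integral_cong) (auto simp: g_def)
    also have "\<dots> = inner2 (\<lambda>z. 1) (\<lambda>z. 0)"
      using 0 S_L2[OF i ge] by (intro inner2_cong) (auto simp: S_def)
    finally show "inner2 (\<lambda>z. g (b z)) (S i (e n)) = 0" by simp
  qed
  then show ?thesis
    unfolding eq2_def by (rule eventually_mono) (auto simp: g_def split: if_splits)
qed

text \<open>Pulling \<open>\<phi> \<circ> b\<close> out of every \<open>S i\<close> turns the sum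
  into \<open>\<phi> \<circ> b\<close> times \<open>T n f\<close>, with error at most
  \<open>C\<close> times that of \<open>T n f\<close>. The hypotheses on \<open>Sa'\<close> concern
  only its values at \<open>f\<close>, so that adjoints on \<open>L2\<close> and on
  \<open>H2\<close> are both covered.\<close>

lemma alpha_mult_tendsto:
  assumes \<phi>: "\<phi> \<in> Linf" and f: "f \<in> L2"
    and Sa': "\<And>i. i \<in> I \<Longrightarrow> Sa' i f \<in> L2" "\<And>i. i \<in> I \<Longrightarrow> eq2 (Sa' i f) (Sa i f)"
  shows "(\<lambda>n. norm2 (\<lambda>z. (\<Sum>i\<in>I \<inter> {..<n}. S i (mult_op \<phi> (Sa' i f)) z) - mult_op (beta b \<phi>) f z)) \<longlonglongrightarrow> 0"
    and "mult_op (beta b \<phi>) f \<in> L2"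
    and "\<And>i. i \<in> I \<Longrightarrow> mult_op \<phi> (Sa' i f) \<in> L2"
proof -
  obtain C0 where C0: "AE z in circle. cmod (\<phi> z) \<le> C0" and [measurable]: "\<phi> \<in> borel_measurable borel"
    using \<phi> by (auto simp: Linf_def)
  define C where "C = max C0 0"
  have C: "AE z in circle. cmod (\<phi> z) \<le> C" "C \<ge> 0"
    using C0 unfolding C_def by (eventually_elim, simp_all)
  have Cb: "AE z in circle. cmod (\<phi> (b z)) \<le> C" by (rule AE_compose_b[OF _ C(1)]) simp
  have \<phi>b [measurable]: "(\<lambda>z. \<phi> (b z)) \<in> borel_measurable borel" by measurable
  show m1: "mult_op \<phi> (Sa' i f) \<in> L2" if "i \<in> I" for i
    unfolding mult_op_def by (rule L2_mult_bounded[OF Sa'(1)[OF that] _ C(1)]) simp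
  show m2: "mult_op (beta b \<phi>) f \<in> L2"
    unfolding mult_op_def beta_def comp_def by (rule L2_mult_bounded[OF f _ Cb]) simp
  have "norm2 (\<lambda>z. (\<Sum>i\<in>I \<inter> {..<n}. S i (mult_op \<phi> (Sa' i f)) z) - mult_op (beta b \<phi>) f z)
      \<le> C * norm2 (\<lambda>z. f z - T n f z)" for n
  proof -
    have "norm2 (\<lambda>z. (\<Sum>i\<in>I \<inter> {..<n}. S i (mult_op \<phi> (Sa' i f)) z) - mult_op (beta b \<phi>) f z)
        = norm2 (\<lambda>z. \<phi> (b z) * (T n f z - f z))"
    proof (rule norm2_cong)
      have "AE z in circle. \<forall>i\<in>I \<inter> {..<n}. S i (Sa' i f) z = S i (Sa i f) z"
        using S_cong Sa' Sa_L2[OF _ f] unfolding eq2_def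
        by (intro AE_finite_allI) auto
      then show "eq2 (\<lambda>z. (\<Sum>i\<in>I \<inter> {..<n}. S i (mult_op \<phi> (Sa' i f)) z) - mult_op (beta b \<phi>) f z)
          (\<lambda>z. \<phi> (b z) * (T n f z - f z))"
        unfolding eq2_def
      proof eventually_elim
        case (elim z)
        have "(\<Sum>i\<in>I \<inter> {..<n}. S i (mult_op \<phi> (Sa' i f)) z) = (\<Sum>i\<in>I \<inter> {..<n}. \<phi> (b z) * S i (Sa' i f) z)"
          by (simp add: S_def mult_op_def mult_ac)
        also have "\<dots> = \<phi> (b z) * T n f z"
          using elim by (simp add: T_def sum_distrib_left)
        finally show ?case by (simp add: mult_op_def beta_def right_diff_distrib)
      qed
    qed (use f T_L2 S_L2 m1 m2 in auto)
    also have "\<dots> \<le> C * norm2 (\<lambda>z. T n f z - f z)"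
      by (rule norm2_mult_bounded[OF _ _ Cb C(2)]) (use f T_L2 in auto)
    finally show ?thesis by (simp add: norm2_minus_commute[of f])
  qed
  then show "(\<lambda>n. norm2 (\<lambda>z. (\<Sum>i\<in>I \<inter> {..<n}. S i (mult_op \<phi> (Sa' i f)) z) - mult_op (beta b \<phi>) f z)) \<longlonglongrightarrow> 0"
    by (intro tendsto_sandwich[OF _ _ tendsto_const tendsto_mult_right_zero[OF T_tendsto[OF f], of C]]) auto
qed

lemma alpha_eq_mult: "\<phi> \<in> Linf \<Longrightarrow> alpha_eq L2 I S (mult_op \<phi>) (mult_op (beta b \<phi>))"
  unfolding alpha_eq_def
proof (intro allI impI ballI)
  fix Sa' f assume \<phi>: "\<phi> \<in> Linf" and adj: "\<forall>i\<in>I. is_adjoint L2 (S i) (Sa' i)" and f: "f \<in> L2"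
  show "(\<lambda>n. norm2 (\<lambda>z. (\<Sum>i\<in>I \<inter> {..<n}. S i (mult_op \<phi> (Sa' i f)) z) - mult_op (beta b \<phi>) f z)) \<longlonglongrightarrow> 0"
  proof (rule alpha_mult_tendsto(1)[OF \<phi> f])
    fix i assume i: "i \<in> I"
    show "Sa' i f \<in> L2" using adj i f by (auto simp: is_adjoint_def bounded_op_def)
    show "eq2 (Sa' i f) (Sa i f)"
      using adjoint_unique[OF closed_subspace_L2 S_L2[OF i] bspec[OF adj i] is_adjoint_Sa[OF i] f] .
  qed
qed

lemma inner2_S_projH2:
  assumes i: "i \<in> I" and g: "g \<in> L2" and h: "h \<in> H2"
  shows "inner2 (S i (projH2 g)) h = inner2 (S i g) h"
  using assms by (simp add: inner2_S_adjoint projH2_L2 H2_L2 inner2_projH2 Sa_H2)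

text \<open>The Toeplitz error \<open>G n\<close> is a.e. the projection to \<open>H2\<close> of the
  multiplication error \<open>D n\<close>, and the projection is a contraction, so the limit is
  inherited from \<open>L2\<close>.\<close>

lemma alpha_eq_toeplitz: "\<phi> \<in> Linf \<Longrightarrow> alpha_eq H2 I S (toeplitz \<phi>) (toeplitz (beta b \<phi>))"
  unfolding alpha_eq_def
proof (intro allI impI ballI)
  fix Sa' f assume \<phi>: "\<phi> \<in> Linf" and adj: "\<forall>i\<in>I. is_adjoint H2 (S i) (Sa' i)" and f: "f \<in> H2"
  have Sa'H: "Sa' i f \<in> H2" if "i \<in> I" for i
    using adj that f by (auto simp: is_adjoint_def bounded_op_def)
  have Sa'L: "Sa' i f \<in> L2" if "i \<in> I" for i using Sa'H[OF that] by (rule H2_L2)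
  have Sa'e: "eq2 (Sa' i f) (Sa i f)" if i: "i \<in> I" for i
    using adjoint_unique[OF closed_subspace_H2 S_H2[OF i] bspec[OF adj i] is_adjoint_Sa_H2[OF i] f] .
  note A1 = alpha_mult_tendsto(1)[where Sa'=Sa', OF \<phi> H2_L2[OF f] Sa'L Sa'e]
  have A2: "mult_op (beta b \<phi>) f \<in> L2"
    by (rule alpha_mult_tendsto(2)[where Sa'=Sa', OF \<phi> H2_L2[OF f] Sa'L Sa'e])
  have A3: "mult_op \<phi> (Sa' i f) \<in> L2" if "i \<in> I" for i
    by (rule alpha_mult_tendsto(3)[where Sa'=Sa', OF \<phi> H2_L2[OF f] Sa'L Sa'e that])
  define D where "D n z = (\<Sum>i\<in>I \<inter> {..<n}. S i (mult_op \<phi> (Sa' i f)) z) - mult_op (beta b \<phi>) f z" for n z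
  have SL: "S i (mult_op \<phi> (Sa' i f)) \<in> L2" if "i \<in> I" for i by (rule S_L2[OF that A3[OF that]])
  have D: "D n \<in> L2" for n unfolding D_def by (intro L2_diff L2_sum) (auto intro: SL A2)
  define G where "G n z = (\<Sum>i\<in>I \<inter> {..<n}. S i (toeplitz \<phi> (Sa' i f)) z) - toeplitz (beta b \<phi>) f z" for n z
  have SH: "S i (toeplitz \<phi> (Sa' i f)) \<in> H2" if "i \<in> I" for i
    unfolding toeplitz_def by (intro S_H2 that projH2_in A3)
  have TH: "toeplitz (beta b \<phi>) f \<in> H2" unfolding toeplitz_def by (intro projH2_in A2)
  have G: "G n \<in> H2" for n
    unfolding G_def
    by (intro closed_subspace_diff[OF closed_subspace_H2] closed_subspace_sum[OF closed_subspace_H2] TH SH) auto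
  have "eq2 (projH2 (D n)) (G n)" for n
  proof (rule projH2_eqI[OF D G])
    fix h assume h: "h \<in> H2"
    have SL': "S i (toeplitz \<phi> (Sa' i f)) \<in> L2" if "i \<in> I \<inter> {..<n}" for i
      using SH that by (intro H2_L2) simp
    have "inner2 (G n) h = (\<Sum>i\<in>I \<inter> {..<n}. inner2 (S i (toeplitz \<phi> (Sa' i f))) h) - inner2 (toeplitz (beta b \<phi>) f) h"
      unfolding G_def by (intro inner2_sum_diff_left SL' H2_L2[OF TH] H2_L2[OF h])
    also have "\<dots> = (\<Sum>i\<in>I \<inter> {..<n}. inner2 (S i (mult_op \<phi> (Sa' i f))) h) - inner2 (mult_op (beta b \<phi>) f) h"
      unfolding toeplitz_def using h by (auto simp: inner2_S_projH2 inner2_projH2 A2 A3)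
    also have "\<dots> = inner2 (D n) h"
      unfolding D_def by (intro inner2_sum_diff_left[symmetric] SL A2 H2_L2[OF h]) simp
    finally show "inner2 (D n) h = inner2 (G n) h" ..
  qed
  then have "norm2 (G n) = norm2 (projH2 (D n))" for n
    using G D by (intro norm2_cong) (auto simp: eq2_sym H2_L2 projH2_L2)
  then have le: "norm2 (G n) \<le> norm2 (D n)" for n using norm2_projH2_le[OF D] by simp
  have "(\<lambda>n. norm2 (D n)) \<longlonglongrightarrow> 0"
    unfolding D_def by (rule A1)
  then have "(\<lambda>n. norm2 (G n)) \<longlonglongrightarrow> 0"
    by (rule Lim_null_comparison[rotated]) (simp add: le)
  then show "(\<lambda>n. norm2 (\<lambda>z. (\<Sum>i\<in>I \<inter> {..<n}. S i (toeplitz \<phi> (Sa' i f)) z) - toeplitz (beta b \<phi>) f z)) \<longlonglongrightarrow> 0"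
    unfolding G_def .
qed

end

theorem theorem3p3:
  fixes b :: cfun and N :: enat and v :: "nat \<Rightarrow> cfun"
  assumes "inner_function b" and "nonconstant b"
    and "N \<ge> 1"
    and "orthonormal_basis (idx N) v (Dspace b)"
  shows "\<exists>S. cuntz_family L2 (idx N) S
          \<and> (\<forall>i\<in>idx N. \<forall>n. eq2 (S i (e n)) (\<lambda>z. v i z * b z powi n))
          \<and> (\<forall>S'. cuntz_family L2 (idx N) S'
                  \<and> (\<forall>i\<in>idx N. \<forall>n. eq2 (S' i (e n)) (\<lambda>z. v i z * b z powi n))
                  \<longrightarrow> (\<forall>i\<in>idx N. op_eq L2 (S' i) (S i)))
          \<and> (\<forall>\<phi>\<in>Linf. alpha_eq L2 (idx N) S (mult_op \<phi>) (mult_op (beta b \<phi>)))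
          \<and> (\<forall>i\<in>idx N. reduces H2 (S i))
          \<and> cuntz_family H2 (idx N) S
          \<and> (\<forall>\<phi>\<in>Linf. alpha_eq H2 (idx N) S (toeplitz \<phi>) (toeplitz (beta b \<phi>)))"
proof -
  interpret cuntz_inner b "idx N" v
    by unfold_locales (use assms in auto)
  have S_e': "S i (e n) = (\<lambda>z. v i z * b z powi n)" for i n
    by (simp add: S_def e_def)
  show ?thesis
  proof (intro exI[of _ S] conjI allI impI ballI)
    fix S' i
    assume S': "cuntz_family L2 (idx N) S' \<and> (\<forall>i\<in>idx N. \<forall>n. eq2 (S' i (e n)) (\<lambda>z. v i z * b z powi n))"
      and i: "i \<in> idx N"
    then show "op_eq L2 (S' i) (S i)"
      by (intro S_unique[OF i]) (auto simp: cuntz_family_def S_e')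
  qed (auto simp: S_e' cuntz_family_L2 cuntz_family_H2 alpha_eq_mult alpha_eq_toeplitz reduces_S)
qed

end
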